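(* Let $\Omega\subseteq\mathbb{R}^n$ ($n\ge2$) be a domain which is star-shaped with respect to the origin, meaning that $(x,\nu)\ge 0$ for any $x\in\partial\Omega$. Let $F=F(s)=F(s_1,\dots,s_n)\in C^1(\mathbb{R}^n)$ satisfy $F(0)=0$ and $$\frac{n-2}{2}\,s^k\frac{\partial F}{\partial s^k}(s)-nF(s)\ge 0\qquad\text{for any } s\in\mathbb{R}^n,$$ and suppose that equality holds here if and only if $s=0$. Let $f_i=\partial F/\partial s^i$ and $f=(f_1,\dots,f_n)$. Then neither of the following two systems has a non-trivial (i.e. not identically zero) classical solution $u\in C^2(\Omega;\mathbb{R}^n)\cap C^1(\overline\Omega;\mathbb{R}^n)$ subject to the homogeneous Dirichlet boundary condition $u=0$ on $\partial\Omega$: (a) the forced isotropic Navier system $\mu\Delta u+(\mu+\lambda)\nabla(\nabla\cdot u)+f(u)=0$ in $\Omega$, where $\mu,\lambda$ are real constants with $\mu>0$ and $\mu+\lambda>0$; (b) the forced anisotropic elastic system $C^{kl}_{ij}\,u^j_{kl}+f_i(u)=0$ in $\Omega$, $i=1,\dots,n$.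
   Context: Summation over repeated indices, running from $1$ to $n$, is understood. Subscripts on $u=(u^1,\dots,u^n)$ denote partial derivatives: $u^k_i=\partial u^k/\partial x_i$, $u^k_{ij}=\partial^2u^k/\partial x_i\partial x_j$; $\Delta u$ is the component-wise Laplacian and $\nabla\cdot u=u^i_i$ is the divergence. The boundary $\partial\Omega$ is sufficiently (piecewise) smooth, $\nu$ is its outward unit normal, and $(\cdot,\cdot)$ is the Euclidean scalar product. Components of $s$ are written $s^k=s_k$. The elastic moduli $C^{kl}_{ij}$ are real constants with the symmetries $C^{kl}_{ij}=C^{il}_{kj}=C^{kj}_{il}=C^{lk}_{ji}$ and satisfying $C^{kl}_{ij}a^i_ka^j_l\ge0$ for every real matrix $(a^p_q)$.
   Formalization: The domain Ω is additionally assumed bounded; without this the claim fails, e.g. Ω = ℝⁿ or the half-space x₁ > 0, F(s) = −|s|²/2, u = (sinh(kx₁),0,…,0) with (2μ+λ)k² = 1 solves (a). *)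

theory Defs
  imports "HOL-Analysis.Analysis"
begin

definition partial_deriv ::
  "'n \<Rightarrow> (real^'n \<Rightarrow> 'b::real_normed_vector) \<Rightarrow> real^'n \<Rightarrow> 'b"
  where "partial_deriv i g x = frechet_derivative g (at x) (axis i 1)"

definition gradient :: "(real^'n \<Rightarrow> real) \<Rightarrow> real^'n \<Rightarrow> real^'n"
  where "gradient g x = (\<chi> i. partial_deriv i g x)"

definition divergence :: "(real^'n \<Rightarrow> real^'n) \<Rightarrow> real^'n \<Rightarrow> real"
  where "divergence u x = (\<Sum>i\<in>UNIV. partial_deriv i u x $ i)"

definition laplacian ::
  "(real^'n \<Rightarrow> 'b::real_normed_vector) \<Rightarrow> real^'n \<Rightarrow> 'b"
  where "laplacian u x = (\<Sum>i\<in>UNIV. partial_deriv i (partial_deriv i u) x)"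

definition C1_on :: "(real^'n) set \<Rightarrow> (real^'n \<Rightarrow> 'b::real_normed_vector) \<Rightarrow> bool"
  where "C1_on U g \<longleftrightarrow>
    (\<forall>x\<in>U. g differentiable (at x)) \<and> (\<forall>i. continuous_on U (partial_deriv i g))"

definition C2_on :: "(real^'n) set \<Rightarrow> (real^'n \<Rightarrow> 'b::real_normed_vector) \<Rightarrow> bool"
  where "C2_on U g \<longleftrightarrow> C1_on U g \<and> (\<forall>i. C1_on U (partial_deriv i g))"

(* The space C^1 of the closure of the open set U: the function is continuous up to the
   boundary and its first derivatives, taken in U only, extend continuously to the closure.
   No differentiability at boundary points or extension of g beyond the closure is demanded. *)
definition C1_on_closure ::
  "(real^'n) set \<Rightarrow> (real^'n \<Rightarrow> 'b::real_normed_vector) \<Rightarrow> bool"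
  where "C1_on_closure U g \<longleftrightarrow>
    C1_on U g \<and> continuous_on (closure U) g \<and>
    (\<forall>i. \<exists>G. continuous_on (closure U) G \<and> (\<forall>x\<in>U. G x = partial_deriv i g x))"

(* Near x the set W is the sublevel set of a C^1 function g with non-vanishing gradient at
   x; then x is a smooth boundary point and nu, the normalised gradient, does not depend on
   the choice of g. *)
definition outward_unit_normal :: "(real^'n) set \<Rightarrow> real^'n \<Rightarrow> real^'n \<Rightarrow> bool"
  where "outward_unit_normal W x \<nu> \<longleftrightarrow>
    (\<exists>U g. open U \<and> x \<in> U \<and> C1_on U g \<and> g x = 0 \<and> gradient g x \<noteq> 0 \<and>
       W \<inter> U = {y \<in> U. g y < 0} \<and>
       \<nu> = gradient g x /\<^sub>R norm (gradient g x))"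

(* Vanishing (n-1)-dimensional Hausdorff measure. For n >= 2 no bound on the radii is
   needed, since a small sum already forces every radius to be small. *)
definition hypersurface_null :: "(real^'n) set \<Rightarrow> bool"
  where "hypersurface_null S \<longleftrightarrow>
    (\<forall>\<epsilon>>0. \<exists>(c :: nat \<Rightarrow> real^'n) (r :: nat \<Rightarrow> real).
       (\<forall>m. 0 < r m) \<and> S \<subseteq> (\<Union>m. ball (c m) (r m)) \<and>
       summable (\<lambda>m. r m ^ (CARD('n) - 1)) \<and>
       (\<Sum>m. r m ^ (CARD('n) - 1)) < \<epsilon>)"

(* Smooth up to edges, corners, etc.: the boundary points without a normal, taken together,
   have (n-1)-dimensional measure zero. This covers C^1 domains as well as polyhedra. *)
definition piecewise_smooth_boundary :: "(real^'n) set \<Rightarrow> bool"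
  where "piecewise_smooth_boundary W \<longleftrightarrow>
    hypersurface_null {x \<in> frontier W. \<nexists>\<nu>. outward_unit_normal W x \<nu>}"

definition star_shaped_wrt_origin :: "(real^'n) set \<Rightarrow> bool"
  where "star_shaped_wrt_origin W \<longleftrightarrow>
    (\<forall>x\<in>frontier W. \<forall>\<nu>. outward_unit_normal W x \<nu> \<longrightarrow> 0 \<le> x \<bullet> \<nu>)"

definition navier_system ::
  "real \<Rightarrow> real \<Rightarrow> (real^'n \<Rightarrow> real^'n) \<Rightarrow> (real^'n) set \<Rightarrow> (real^'n \<Rightarrow> real^'n) \<Rightarrow> bool"
  where "navier_system \<mu> lam f W u \<longleftrightarrow>
    (\<forall>x\<in>W. \<mu> *\<^sub>R laplacian u x + (\<mu> + lam) *\<^sub>R gradient (divergence u) x + f (u x) = 0)"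

(* In all that follows, C k l i j stands for the modulus with upper indices k l and lower
   indices i j. *)
definition elastic_moduli :: "('n::finite \<Rightarrow> 'n \<Rightarrow> 'n \<Rightarrow> 'n \<Rightarrow> real) \<Rightarrow> bool"
  where "elastic_moduli C \<longleftrightarrow>
    (\<forall>k l i j. C k l i j = C i l k j \<and> C k l i j = C k j i l \<and> C k l i j = C l k j i) \<and>
    (\<forall>a :: real^'n^'n.
       0 \<le> (\<Sum>i\<in>UNIV. \<Sum>j\<in>UNIV. \<Sum>k\<in>UNIV. \<Sum>l\<in>UNIV. C k l i j * a $ i $ k * a $ j $ l))"

definition anisotropic_system ::
  "('n \<Rightarrow> 'n \<Rightarrow> 'n \<Rightarrow> 'n \<Rightarrow> real) \<Rightarrow> (real^'n \<Rightarrow> real^'n) \<Rightarrow> (real^'n) set \<Rightarrow>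
    (real^'n \<Rightarrow> real^'n) \<Rightarrow> bool"
  where "anisotropic_system C f W u \<longleftrightarrow>
    (\<forall>x\<in>W. \<forall>i.
       (\<Sum>j\<in>UNIV. \<Sum>k\<in>UNIV. \<Sum>l\<in>UNIV.
          C k l i j * partial_deriv l (partial_deriv k u) x $ j) + f (u x) $ i = 0)"

end

theory Submission
  imports Defs
begin

text \<open>
  The proof rests on Pohozaev's identity. Both systems have the form
  \<open>\<partial>\<^sub>l \<sigma>\<^sub>i\<^sub>l + f\<^sub>i(u) = 0\<close> with a stress \<open>\<sigma>\<close> that depends linearly on the gradient of \<open>u\<close>, where the
  moduli are symmetric under exchange of the two index pairs and the energy \<open>\<sigma>\<^sub>i\<^sub>l \<partial>\<^sub>l u\<^sup>i\<close> is nonnegative; for the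
  Navier system such moduli are written down explicitly. Multiplying the system by
  \<open>(x \<bullet> \<nabla>) u + (n - 2) / 2 * u\<close> and collecting terms produces a vector field \<open>P\<close>, built from \<open>x\<close>, \<open>u\<close>
  and the gradient of \<open>u\<close>, with
  \<open>div P = n F(u) - (n - 2) / 2 * (u \<bullet> f(u))\<close> (lemma \<open>divergence_pohozaev_flux\<close>). By hypothesis this is negative
  wherever \<open>u\<close> is not zero, and zero elsewhere. On the boundary \<open>u\<close> vanishes, so its gradient is purely normal
  (\<open>boundary_gradient_normal\<close>), and \<open>P \<bullet> \<nu>\<close> becomes \<open>x \<bullet> \<nu>\<close> times half the energy, which is nonnegative
  for a star-shaped domain (\<open>pohozaev_flux_boundary\<close>). The divergence theorem then gives
  \<open>0 \<le> \<integral> P \<bullet> \<nu> = \<integral> div P \<le> 0\<close>, so that \<open>div P\<close>, and with it \<open>u\<close>, vanishes identically.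

  The divergence theorem enters through the inequality \<open>0 \<le> \<integral> div P\<close>, which depends on the flux by its sign
  alone. This makes it possible to prove it without a surface measure (\<open>integral_divergence_nonneg\<close>), for fields that are
  continuous up to the boundary and have a bounded divergence inside. Everything is reduced to the fact that the
  divergence of a compactly supported field integrates to zero. Near a smooth boundary point the field is
  multiplied by a function of \<open>g\<close>, the defining function of the domain, that drops to zero in a thin layer
  inside the boundary; the derivative of this factor produces the flux, weighted by a mass that remains bounded
  as the layer shrinks. Smooth boundary points are then combined by a finite
  cover, and the remaining ones are cut out by bump functions supported in small balls whose gradients have a total
  integral as small as one likes, because the points cut out form a set of vanishing \<open>(n - 1)\<close>-dimensional measure.
\<close>

section \<open>Calculus of continuously differentiable functions\<close>

lemma partial_deriv_eq:
  assumes "(g has_derivative g') (at x)"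
  shows "partial_deriv i g x = g' (axis i 1)"
  unfolding partial_deriv_def using frechet_derivative_at[OF assms] by simp

lemma linear_eq_sum_axis:
  fixes L :: "real^'n \<Rightarrow> 'b::real_normed_vector"
  assumes "linear L"
  shows "L h = (\<Sum>i\<in>UNIV. h $ i *\<^sub>R L (axis i 1))"
proof -
  have "L h = L (\<Sum>i\<in>UNIV. h $ i *\<^sub>R axis i 1)"
    by (metis (no_types) basis_expansion scalar_mult_eq_scaleR)
  also have "\<dots> = (\<Sum>i\<in>UNIV. h $ i *\<^sub>R L (axis i 1))"
    using assms by (simp add: linear_sum linear_cmul)
  finally show ?thesis .
qed

lemma has_derivative_sum_partial_deriv:
  fixes g :: "real^'n \<Rightarrow> 'b::real_normed_vector"
  assumes "g differentiable (at x)"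
  shows "(g has_derivative (\<lambda>h. \<Sum>i\<in>UNIV. h $ i *\<^sub>R partial_deriv i g x)) (at x)"
proof -
  have D: "(g has_derivative frechet_derivative g (at x)) (at x)"
    using assms frechet_derivative_works by blast
  have "frechet_derivative g (at x) = (\<lambda>h. \<Sum>i\<in>UNIV. h $ i *\<^sub>R partial_deriv i g x)"
    unfolding partial_deriv_def using linear_eq_sum_axis[OF has_derivative_linear[OF D]] by blast
  then show ?thesis using D by simp
qed

text \<open>Any derivative will do to establish \<^const>\<open>C1_on\<close>: it agrees with the Frechet derivative by uniqueness, so only
  its values on the coordinate axes have to be continuous.\<close>

lemma C1_onI:
  assumes "\<And>x. x \<in> U \<Longrightarrow> (g has_derivative g' x) (at x)"
    and "\<And>i. continuous_on U (\<lambda>x. g' x (axis i 1))"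
  shows "C1_on U g"
  unfolding C1_on_def
proof (intro conjI ballI allI)
  fix i show "continuous_on U (partial_deriv i g)"
    by (rule continuous_on_eq[OF assms(2)]) (simp add: partial_deriv_eq[OF assms(1)])
qed (use assms(1) differentiable_def in blast)

lemma C1_on_has_derivative:
  assumes "C1_on U g" "x \<in> U"
  shows "(g has_derivative (\<lambda>h. \<Sum>i\<in>UNIV. h $ i *\<^sub>R partial_deriv i g x)) (at x)"
  using assms has_derivative_sum_partial_deriv unfolding C1_on_def by blast

lemma C1_on_subset: "C1_on U g \<Longrightarrow> V \<subseteq> U \<Longrightarrow> C1_on V g"
  unfolding C1_on_def by (meson continuous_on_subset subsetD)

lemma C1_on_imp_continuous_on: "C1_on U g \<Longrightarrow> continuous_on U g"
  unfolding C1_on_def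
  by (meson continuous_at_imp_continuous_on differentiable_imp_continuous_within)

lemma C1_on_const: "C1_on U (\<lambda>x. c)"
  by (rule C1_onI[where g' = "\<lambda>x h. 0"]) auto

lemma C1_on_imp_GDERIV:
  assumes "C1_on U g" "x \<in> U"
  shows "GDERIV g x :> gradient g x"
  using C1_on_has_derivative[OF assms]
  by (simp add: gderiv_def gradient_def inner_vec_def)

lemma gradient_eq:
  assumes "GDERIV g x :> d"
  shows "gradient g x = d"
  using partial_deriv_eq[OF assms[unfolded gderiv_def]]
  by (simp add: gradient_def vec_eq_iff inner_commute inner_axis)

lemma C1_on_gradient_continuous: "C1_on U g \<Longrightarrow> continuous_on U (gradient g)"
  unfolding C1_on_def gradient_def by (simp add: continuous_on_vec_lambda)

lemma C1_on_GDERIVI: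
  assumes "\<And>x. x \<in> U \<Longrightarrow> GDERIV g x :> d x" "continuous_on U d"
  shows "C1_on U g"
  using assms by (intro C1_onI[where g' = "\<lambda>x h. h \<bullet> d x"])
    (auto simp: gderiv_def intro!: continuous_intros)

lemma gradient_mult:
  assumes "C1_on U a" "C1_on U b" "x \<in> U"
  shows "gradient (\<lambda>x. a x * b x) x = a x *\<^sub>R gradient b x + b x *\<^sub>R gradient a x"
  by (rule gradient_eq) (intro GDERIV_mult C1_on_imp_GDERIV[OF _ assms(3)] assms)

lemma C1_on_mult:
  assumes "C1_on U a" "C1_on U b"
  shows "C1_on U (\<lambda>x. a x * b x :: real)"
proof (rule C1_on_GDERIVI)
  show "continuous_on U (\<lambda>x. a x *\<^sub>R gradient b x + b x *\<^sub>R gradient a x)"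
    using assms by (intro continuous_intros C1_on_imp_continuous_on C1_on_gradient_continuous)
qed (intro GDERIV_mult C1_on_imp_GDERIV[where U=U] assms)

lemma gradient_one_minus:
  assumes "C1_on U a" "x \<in> U"
  shows "gradient (\<lambda>x. 1 - a x) x = - gradient a x"
  by (rule gradient_eq, rule GDERIV_subst)
    (rule GDERIV_diff[OF GDERIV_const C1_on_imp_GDERIV[OF assms]], simp)

lemma C1_on_one_minus:
  assumes "C1_on U a"
  shows "C1_on U (\<lambda>x. 1 - a x :: real)"
  using C1_on_gradient_continuous[OF assms]
    GDERIV_diff[OF GDERIV_const C1_on_imp_GDERIV[OF assms]]
  by (intro C1_on_GDERIVI[where d = "\<lambda>x. 0 - gradient a x"])
    (auto intro!: continuous_intros)

lemma C1_on_compose_real: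
  assumes "C1_on U a" "\<And>t. (\<phi> has_real_derivative \<phi>' t) (at t)" "continuous_on UNIV \<phi>'"
  shows "C1_on U (\<lambda>x. \<phi> (a x))"
    and "\<And>x. x \<in> U \<Longrightarrow> gradient (\<lambda>x. \<phi> (a x)) x = \<phi>' (a x) *\<^sub>R gradient a x"
proof -
  have D: "GDERIV (\<lambda>x. \<phi> (a x)) x :> \<phi>' (a x) *\<^sub>R gradient a x" if "x \<in> U" for x
    by (rule GDERIV_DERIV_compose[OF C1_on_imp_GDERIV[OF assms(1) that] assms(2)])
  show "C1_on U (\<lambda>x. \<phi> (a x))"
    using continuous_on_compose2[OF assms(3) C1_on_imp_continuous_on[OF assms(1)]]
    by (intro C1_on_GDERIVI[OF D])
      (auto intro!: continuous_on_scaleR C1_on_gradient_continuous[OF assms(1)])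
  show "gradient (\<lambda>x. \<phi> (a x)) x = \<phi>' (a x) *\<^sub>R gradient a x" if "x \<in> U" for x
    by (rule gradient_eq[OF D[OF that]])
qed

lemma
  fixes P :: "real^'n \<Rightarrow> real^'n"
  assumes \<psi>: "C1_on U \<psi>" and P: "C1_on U P"
  shows C1_on_scaleR: "C1_on U (\<lambda>x. \<psi> x *\<^sub>R P x)"
    and divergence_scaleR: "\<And>x. x \<in> U \<Longrightarrow>
      divergence (\<lambda>x. \<psi> x *\<^sub>R P x) x = \<psi> x * divergence P x + P x \<bullet> gradient \<psi> x"
proof -
  let ?d = "\<lambda>x h. \<psi> x *\<^sub>R (\<Sum>i\<in>UNIV. h $ i *\<^sub>R partial_deriv i P x) + (h \<bullet> gradient \<psi> x) *\<^sub>R P x"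
  have D: "((\<lambda>x. \<psi> x *\<^sub>R P x) has_derivative ?d x) (at x)" if "x \<in> U" for x
    using has_derivative_scaleR[OF C1_on_imp_GDERIV[OF \<psi> that, unfolded gderiv_def]
        C1_on_has_derivative[OF P that]] by simp
  have ax: "?d x (axis i 1) = \<psi> x *\<^sub>R partial_deriv i P x + gradient \<psi> x $ i *\<^sub>R P x" for x i
    by (simp add: axis_def if_distrib[of "\<lambda>z. z *\<^sub>R _"] inner_vec_def
        if_distrib[of "\<lambda>z. z * _"] cong: if_cong)
  show "C1_on U (\<lambda>x. \<psi> x *\<^sub>R P x)"
  proof (rule C1_onI[OF D])
    fix i show "continuous_on U (\<lambda>x. ?d x (axis i 1))"
      unfolding ax using \<psi> P C1_on_gradient_continuous[OF \<psi>]
        C1_on_imp_continuous_on[OF \<psi>] C1_on_imp_continuous_on[OF P]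
      by (auto simp: C1_on_def intro!: continuous_intros)
  qed
  fix x assume x: "x \<in> U"
  have "divergence (\<lambda>x. \<psi> x *\<^sub>R P x) x = (\<Sum>i\<in>UNIV. ?d x (axis i 1) $ i)"
    unfolding divergence_def partial_deriv_eq[OF D[OF x]] by simp
  also have "\<dots> = \<psi> x * divergence P x + P x \<bullet> gradient \<psi> x"
    unfolding ax by (simp add: divergence_def sum.distrib sum_distrib_left inner_vec_def mult.commute)
  finally show "divergence (\<lambda>x. \<psi> x *\<^sub>R P x) x = \<psi> x * divergence P x + P x \<bullet> gradient \<psi> x" .
qed

section \<open>Fields of compact support\<close>

text \<open>The integral of a difference quotient of a compactly supported function vanishes because Lebesgue
  measure is translation invariant; the mean value theorem bounds the quotients uniformly, so dominated
  convergence passes to the derivative.\<close>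

lemma integral_directional_derivative_zero:
  fixes h :: "'a::euclidean_space \<Rightarrow> real"
  assumes der: "\<And>x. (h has_derivative h' x) (at x)"
    and cont: "continuous_on UNIV (\<lambda>x. h' x e)"
    and K: "compact K" "\<And>x. x \<notin> K \<Longrightarrow> h x = 0"
  shows "integrable lborel (\<lambda>x. h' x e)" "(\<integral>x. h' x e \<partial>lborel) = 0"
proof -
  have hc: "continuous_on UNIV h"
    using der by (meson continuous_at_imp_continuous_on has_derivative_continuous)
  have [measurable]: "h \<in> borel_measurable borel" "(\<lambda>x. h' x e) \<in> borel_measurable borel"
    using hc cont by (auto intro: borel_measurable_continuous_onI)
  have h'0: "h' x e = 0" if "x \<notin> K" for x
  proof -
    have "(h has_derivative (\<lambda>h. 0)) (at x)"
      by (rule has_derivative_transform_within_open[of "\<lambda>x. 0" _ _ _ "- K"])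
        (use K that compact_imp_closed in auto)
    then show ?thesis using has_derivative_unique[OF der] by metis
  qed
  obtain M where M: "\<And>x. x \<in> K \<Longrightarrow> \<bar>h' x e\<bar> \<le> M"
    using compact_imp_bounded[OF compact_continuous_image[OF continuous_on_subset[OF cont] K(1)]]
    by (auto simp: bounded_iff)
  define M' where "M' = max M 0"
  have M': "\<bar>h' x e\<bar> \<le> M'" for x
    using M[of x] h'0[of x] unfolding M'_def by (cases "x \<in> K") auto
  obtain N where N: "\<And>x. x \<in> K \<Longrightarrow> \<bar>h x\<bar> \<le> N"
    using compact_imp_bounded[OF compact_continuous_image[OF continuous_on_subset[OF hc] K(1)]]
    by (auto simp: bounded_iff)
  obtain R where R: "\<And>x. x \<in> K \<Longrightarrow> norm x \<le> R"
    using compact_imp_bounded[OF K(1)] by (auto simp: bounded_iff)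
  have int_h: "integrable lborel h"
  proof (rule integrableI_bounded_set[where A = K and B = N])
    show "K \<in> sets lborel" using K(1) by (simp add: compact_imp_closed)
    show "emeasure lborel K < \<infinity>" by (rule emeasure_compact_finite[OF K(1)])
  qed (use N K(2) in auto)
  show int_h': "integrable lborel (\<lambda>x. h' x e)"
  proof (rule integrableI_bounded_set[where A = K and B = M])
    show "K \<in> sets lborel" using K(1) by (simp add: compact_imp_closed)
    show "emeasure lborel K < \<infinity>" by (rule emeasure_compact_finite[OF K(1)])
  qed (use M h'0 in auto)
  define s where "s n x = (h (inverse (real (Suc n)) *\<^sub>R e + x) - h x) * real (Suc n)" for n x
  have s_int: "integral\<^sup>L lborel (s n) = 0" for n
  proof -
    let ?c = "inverse (real (Suc n)) *\<^sub>R e"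
    have i: "integrable lborel (\<lambda>x. h (?c + x))"
      using int_h integrable_distr[of "(+) ?c" lborel borel h]
      by (simp add: lborel_distr_plus)
    have "(\<integral>x. h (?c + x) \<partial>lborel) = integral\<^sup>L (distr lborel borel ((+) ?c)) h"
      by (subst integral_distr) auto
    also have "\<dots> = integral\<^sup>L lborel h" by (simp add: lborel_distr_plus)
    finally show ?thesis
      unfolding s_def using i int_h by simp
  qed
  have s_lim: "(\<lambda>n. s n x) \<longlonglongrightarrow> h' x e" for x
  proof -
    have "((\<lambda>t. h (x + t *\<^sub>R e)) has_derivative (\<lambda>t. h' x (t *\<^sub>R e))) (at 0)"
      by (rule has_derivative_compose[of "\<lambda>t. x + t *\<^sub>R e" "\<lambda>t. t *\<^sub>R e" 0 UNIV h "h' x", simplified])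
        (auto intro!: derivative_eq_intros der)
    then have "((\<lambda>t. h (x + t *\<^sub>R e)) has_real_derivative h' x e) (at 0)"
      unfolding has_field_derivative_def
      by (simp add: linear_cmul[OF has_derivative_linear[OF der]] mult.commute[of _ "h' x e"])
    then have "(\<lambda>t. (h (x + t *\<^sub>R e) - h x) / t) \<midarrow>0\<rightarrow> h' x e"
      by (simp add: DERIV_def)
    moreover have "filterlim (\<lambda>n. inverse (real (Suc n))) (at 0) sequentially"
      by (rule filterlim_atI[OF LIMSEQ_inverse_real_of_nat]) simp
    ultimately have "(\<lambda>n. (h (x + inverse (real (Suc n)) *\<^sub>R e) - h x) / inverse (real (Suc n))) \<longlonglongrightarrow> h' x e"
      by (rule filterlim_compose)
    then show ?thesis unfolding s_def by (simp add: field_simps add.commute)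
  qed
  have lip: "\<bar>h (t *\<^sub>R e + x) - h x\<bar> \<le> M' * t" if "0 < t" for t x
  proof -
    have d: "((\<lambda>t. h (x + t *\<^sub>R e)) has_derivative (\<lambda>r. r * h' (x + t *\<^sub>R e) e)) (at t within S)" for t S
    proof -
      have "((\<lambda>t. h (x + t *\<^sub>R e)) has_derivative (\<lambda>r. h' (x + t *\<^sub>R e) (r *\<^sub>R e))) (at t within S)"
        by (rule has_derivative_compose[of "\<lambda>t. x + t *\<^sub>R e" "\<lambda>t. t *\<^sub>R e" t S h "h' (x + t *\<^sub>R e)"])
          (auto intro!: derivative_eq_intros der)
      then show ?thesis by (simp add: linear_cmul[OF has_derivative_linear[OF der]])
    qed
    have "onorm (\<lambda>r. r * h' (x + s *\<^sub>R e) e) \<le> M'" for s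
    proof (rule onorm_le)
      show "norm (r * h' (x + s *\<^sub>R e) e) \<le> M' * norm r" for r
        using mult_left_mono[OF M'[of "x + s *\<^sub>R e"], of "\<bar>r\<bar>"]
        by (simp add: abs_mult mult.commute)
    qed
    then have "\<bar>h (x + t *\<^sub>R e) - h (x + 0 *\<^sub>R e)\<bar> \<le> M' * \<bar>t - 0\<bar>"
      using differentiable_bound[of UNIV "\<lambda>t. h (x + t *\<^sub>R e)" "\<lambda>t r. r * h' (x + t *\<^sub>R e) e" M' t 0] d
      by auto
    then show ?thesis using that by (simp add: add.commute)
  qed
  have "(\<lambda>n. integral\<^sup>L lborel (s n)) \<longlonglongrightarrow> (\<integral>x. h' x e \<partial>lborel)"
  proof (rule integral_dominated_convergence[where w = "\<lambda>x. indicator (cball (0::'a) (R + norm e)) x *\<^sub>R M'"])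
    show "integrable lborel (\<lambda>x. indicator (cball (0::'a) (R + norm e)) x *\<^sub>R M')"
      using emeasure_compact_finite[OF compact_cball, of "0::'a" "R + norm e"]
      by (intro integrable_scaleR_left integrable_real_indicator) auto
    show "s n \<in> borel_measurable lborel" for n unfolding s_def by measurable
    show "AE x in lborel. (\<lambda>n. s n x) \<longlonglongrightarrow> h' x e" using s_lim by auto
    show "AE x in lborel. norm (s n x) \<le> indicator (cball (0::'a) (R + norm e)) x *\<^sub>R M'" for n
    proof (intro AE_I2)
      fix x
      let ?t = "inverse (real (Suc n))"
      show "norm (s n x) \<le> indicator (cball (0::'a) (R + norm e)) x *\<^sub>R M'"
      proof (cases "x \<in> cball (0::'a) (R + norm e)")
        case True
        have "\<bar>s n x\<bar> \<le> (M' * ?t) * real (Suc n)"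
          unfolding s_def abs_mult by (rule mult_mono) (use lip[of ?t x] in auto)
        also have "\<dots> = M'" by (simp del: of_nat_Suc)
        finally show ?thesis using True by simp
      next
        case False
        have t1: "?t \<le> 1" by (simp add: field_simps)
        have "norm x - norm (?t *\<^sub>R e) \<le> norm (?t *\<^sub>R e + x)"
          using norm_triangle_ineq4[of "?t *\<^sub>R e + x" "?t *\<^sub>R e"] by simp
        moreover have "norm (?t *\<^sub>R e) \<le> norm e"
          using mult_right_mono[OF t1, of "norm e"] by simp
        ultimately have "norm (?t *\<^sub>R e + x) > R" using False by simp
        moreover have "norm x > R + norm e" using False by simp
        then have "norm x > R" using norm_ge_zero[of e] by linarith
        ultimately have "?t *\<^sub>R e + x \<notin> K" "x \<notin> K" using R by force+
        then show ?thesis using False K(2) unfolding s_def by auto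
      qed
    qed
  qed simp
  then show "(\<integral>x. h' x e \<partial>lborel) = 0"
    unfolding s_int using LIMSEQ_unique tendsto_const by blast
qed

text \<open>Extended by zero, a field on \<open>W\<close> that vanishes off a compact subset of \<open>W\<close> is continuously
  differentiable on the whole space, so each of its components falls under the previous lemma.\<close>

lemma integral_divergence_zero:
  fixes V :: "real^'n \<Rightarrow> real^'n"
  assumes W: "open W" and V: "C1_on W V"
    and K: "compact K" "K \<subseteq> W" "\<And>x. x \<in> W - K \<Longrightarrow> V x = 0"
  shows "set_integrable lborel W (divergence V)" "(LINT x:W|lborel. divergence V x) = 0"
proof -
  define E where "E x = (if x \<in> W then V x else 0)" for x
  define E' where "E' x h = (if x \<in> W then \<Sum>i\<in>UNIV. h $ i *\<^sub>R partial_deriv i V x else 0)" for x h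
  have clK: "closed K" using K(1) by (rule compact_imp_closed)
  have D: "(E has_derivative E' x) (at x)" for x
  proof (cases "x \<in> W")
    case True
    have "(V has_derivative E' x) (at x)"
      using C1_on_has_derivative[OF V True] True by (simp add: E'_def[abs_def])
    then show ?thesis
      by (rule has_derivative_transform_within_open[OF _ W True]) (simp add: E_def)
  next
    case False
    have "E' x = (\<lambda>h. 0)" using False by (auto simp: E'_def)
    moreover have "(E has_derivative (\<lambda>h. 0)) (at x)"
      by (rule has_derivative_transform_within_open[of "\<lambda>x. 0" _ _ _ "- K"])
        (use K False clK in \<open>auto simp: E_def\<close>)
    ultimately show ?thesis by simp
  qed
  have zero: "E' x h = 0" if "x \<notin> K" for x h
  proof -
    have "(E has_derivative (\<lambda>h. 0)) (at x)"
      by (rule has_derivative_transform_within_open[of "\<lambda>x. 0" _ _ _ "- K"])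
        (use K that clK in \<open>auto simp: E_def\<close>)
    then show ?thesis using has_derivative_unique[OF D] by metis
  qed
  have ax: "E' x (axis i 1) = partial_deriv i V x" if "x \<in> W" for x i
    using that partial_deriv_eq[OF D[of x], of i]
      partial_deriv_eq[OF C1_on_has_derivative[OF V that], of i] by (simp add: E'_def)
  have cont: "continuous_on UNIV (\<lambda>x. E' x (axis i 1) $ i)" for i
  proof -
    have "continuous_on W (\<lambda>x. E' x (axis i 1) $ i)"
      using V by (simp add: ax C1_on_def continuous_on_component cong: continuous_on_cong)
    moreover have "continuous_on (- K) (\<lambda>x. E' x (axis i 1) $ i)"
      by (rule continuous_on_eq[of _ "\<lambda>x. 0"]) (use zero in auto)
    moreover have "W \<union> - K = UNIV" using K(2) by auto
    ultimately show ?thesis using continuous_on_open_Un[OF W, of "- K"] clK by (metis open_Compl)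
  qed
  have D': "((\<lambda>x. E x $ i) has_derivative (\<lambda>h. E' x h $ i)) (at x)" for x i
    by (rule bounded_linear.has_derivative[OF bounded_linear_vec_nth D])
  have "E x $ i = 0" if "x \<notin> K" for x i using that K(3) by (simp add: E_def)
  note I = integral_directional_derivative_zero[OF D' cont K(1) this]
  have eq: "indicator W x *\<^sub>R divergence V x = (\<Sum>i\<in>UNIV. E' x (axis i 1) $ i)" for x
    by (cases "x \<in> W") (simp_all add: ax divergence_def, simp add: E'_def)
  show "set_integrable lborel W (divergence V)"
    unfolding set_integrable_def eq using I(1) by (intro Bochner_Integration.integrable_sum) auto
  show "(LINT x:W|lborel. divergence V x) = 0"
    unfolding set_lebesgue_integral_def eq using I by (subst Bochner_Integration.integral_sum) auto
qed

section \<open>Bounded continuous functions and cut-offs\<close>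

text \<open>Bounded continuous functions are closed under sums and products, and are integrable over bounded
  open sets. All integrands below are of this kind.\<close>

definition bcont :: "'a::metric_space set \<Rightarrow> ('a \<Rightarrow> 'b::real_normed_vector) \<Rightarrow> bool"
  where "bcont W f \<longleftrightarrow> continuous_on W f \<and> bounded (f ` W)"

lemma bcont_compact: "continuous_on K f \<Longrightarrow> compact K \<Longrightarrow> W \<subseteq> K \<Longrightarrow> bcont W f"
  unfolding bcont_def
  by (meson bounded_subset compact_continuous_image compact_imp_bounded continuous_on_subset image_mono)

lemma bcont_bounded:
  fixes f :: "real^'n \<Rightarrow> 'b::real_normed_vector"
  shows "continuous_on UNIV f \<Longrightarrow> bounded W \<Longrightarrow> bcont W f"
  by (rule bcont_compact[of "closure W"]) (auto intro: continuous_on_subset closure_subset[THEN subsetD])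

lemma bcont_subset: "bcont W f \<Longrightarrow> V \<subseteq> W \<Longrightarrow> bcont V f"
  unfolding bcont_def by (meson bounded_subset continuous_on_subset image_mono)

lemma bcont_const: "bcont W (\<lambda>x. c)"
  unfolding bcont_def by (auto intro: bounded_subset[of "{c}"])

lemma bcont_add: "bcont W f \<Longrightarrow> bcont W g \<Longrightarrow> bcont W (\<lambda>x. f x + g x)"
  unfolding bcont_def by (auto intro: continuous_intros bounded_plus_comp)

lemma bcont_inner:
  assumes "bcont W f" "bcont W g" shows "bcont W (\<lambda>x. f x \<bullet> g x)"
proof -
  obtain a b where ab: "\<And>x. x \<in> W \<Longrightarrow> norm (f x) \<le> a" "\<And>x. x \<in> W \<Longrightarrow> norm (g x) \<le> b"
    using assms by (auto simp: bcont_def bounded_iff)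
  have "\<bar>f x \<bullet> g x\<bar> \<le> a * b" if "x \<in> W" for x
    using Cauchy_Schwarz_ineq2[of "f x" "g x"] mult_mono[OF ab[OF that]] ab[OF that]
      norm_ge_zero[of "f x"] norm_ge_zero[of "g x"] by linarith
  then show ?thesis
    using assms by (auto simp: bcont_def bounded_iff intro!: continuous_intros)
qed

lemma bcont_mult: "bcont W f \<Longrightarrow> bcont W g \<Longrightarrow> bcont W (\<lambda>x. f x * g x :: real)"
  using bcont_inner[of W f g] by simp

lemma bcont_norm: "bcont W f \<Longrightarrow> bcont W (\<lambda>x. norm (f x))"
  unfolding bcont_def by (auto intro: continuous_intros simp: bounded_iff)

lemma set_integrable_bcont:
  fixes f :: "real^'n \<Rightarrow> real"
  assumes "bcont W f" "open W" "bounded W"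
  shows "set_integrable lborel W f"
proof -
  obtain B where "\<And>x. x \<in> W \<Longrightarrow> \<bar>f x\<bar> \<le> B"
    using assms by (auto simp: bcont_def bounded_iff)
  moreover have "(\<lambda>x. indicator W x *\<^sub>R f x) \<in> borel_measurable borel"
    using assms by (intro borel_measurable_continuous_on_indicator) (auto simp: bcont_def)
  ultimately show ?thesis unfolding set_integrable_def
    using assms emeasure_bounded_finite[of W]
    by (intro integrableI_bounded_set[where A = W and B = B]) (auto simp: indicator_def)
qed

text \<open>A continuously differentiable step from \<open>0\<close> to \<open>1\<close> on the unit interval: the quadratic spline whose
  derivative is the hat function with apex \<open>2\<close> at \<open>1/2\<close>.\<close>

definition ramp :: "real \<Rightarrow> real"
  where "ramp t = 2 * ((max 0 t)\<^sup>2 - 2 * (max 0 (t - 1/2))\<^sup>2 + (max 0 (t - 1))\<^sup>2)"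

definition ramp' :: "real \<Rightarrow> real"
  where "ramp' t = 4 * (max 0 t - 2 * max 0 (t - 1/2) + max 0 (t - 1))"

lemma DERIV_max_square: "((\<lambda>t. (max 0 t)\<^sup>2) has_real_derivative 2 * max 0 t) (at (t::real))"
proof -
  consider "t > 0" | "t < 0" | "t = 0" by linarith
  then show ?thesis
  proof cases
    case 1
    have "((\<lambda>t. t\<^sup>2) has_real_derivative 2 * max 0 t) (at t)"
      using 1 by (auto intro!: derivative_eq_intros)
    then show ?thesis
      by (rule DERIV_cong_ev[THEN iffD1, rotated -1, OF _ refl _ refl])
        (use eventually_gt_at_top 1 in \<open>auto simp: eventually_nhds intro!: exI[of _ "{0<..}"]\<close>)
  next
    case 2
    have "((\<lambda>t. 0) has_real_derivative 2 * max 0 t) (at t)" using 2 by simp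
    then show ?thesis
      by (rule DERIV_cong_ev[THEN iffD1, rotated -1, OF _ refl _ refl])
        (use 2 in \<open>auto simp: eventually_nhds intro!: exI[of _ "{..<0}"]\<close>)
  next
    case 3
    have "(\<lambda>h. (max 0 h)\<^sup>2 / h) \<midarrow>0\<rightarrow> (0::real)"
    proof (rule tendsto_rabs_zero_cancel, rule tendsto_sandwich[of "\<lambda>h. 0" _ _ "\<lambda>h. \<bar>h\<bar>"])
      show "\<forall>\<^sub>F h in at 0. \<bar>(max 0 h)\<^sup>2 / h\<bar> \<le> \<bar>h :: real\<bar>"
        by (intro always_eventually allI) (auto simp: max_def power2_eq_square)
    qed (auto intro: tendsto_rabs_zero)
    then show ?thesis using 3 by (simp add: DERIV_def)
  qed
qed

lemma DERIV_ramp: "(ramp has_real_derivative ramp' t) (at t)"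
proof -
  have s: "((\<lambda>t. (max 0 (t - a))\<^sup>2) has_real_derivative 2 * max 0 (t - a)) (at t)" for a :: real
  proof -
    have "((\<lambda>t. t - a) has_real_derivative 1) (at t)" by (auto intro!: derivative_eq_intros)
    from DERIV_chain2[OF DERIV_max_square this] show ?thesis by simp
  qed
  show ?thesis unfolding ramp_def[abs_def] ramp'_def
    by (rule DERIV_cong, rule DERIV_cmult, rule DERIV_add, rule DERIV_diff,
        rule DERIV_max_square, rule DERIV_cmult, rule s, rule s) simp
qed

lemma continuous_ramp': "continuous_on UNIV ramp'"
  unfolding ramp'_def[abs_def] by (intro continuous_intros)

lemma ramp'_bounds: "0 \<le> ramp' t" "ramp' t \<le> 2"
  unfolding ramp'_def by (auto simp: max_def)

lemma ramp'_eq_0: "t \<le> 0 \<or> 1 \<le> t \<Longrightarrow> ramp' t = 0"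
  unfolding ramp'_def by (auto simp: max_def)

lemma ramp_eq_0: "t \<le> 0 \<Longrightarrow> ramp t = 0"
  unfolding ramp_def by (auto simp: max_def)

lemma ramp_eq_1: "1 \<le> t \<Longrightarrow> ramp t = 1"
  unfolding ramp_def by (auto simp: max_def power2_eq_square algebra_simps)

lemma ramp_bounds: "0 \<le> ramp t" "ramp t \<le> 1"
proof -
  have mono: "ramp s \<le> ramp t" if "s \<le> t" for s t
    using that DERIV_ramp ramp'_bounds(1) by (meson DERIV_nonneg_imp_nondecreasing)
  show "0 \<le> ramp t" using mono[of "min t 0" t] ramp_eq_0[of "min t 0"] by simp
  show "ramp t \<le> 1" using mono[of t "max t 1"] ramp_eq_1[of "max t 1"] by simp
qed

text \<open>Equal to \<open>1\<close> on the ball of radius \<open>r\<close> and to \<open>0\<close> outside the one of radius \<open>sqrt 2 * r\<close>. Its gradient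
  is of order \<open>1/r\<close> on a set of volume of order \<open>r ^ n\<close>, so its integral is of order \<open>r ^ (n - 1)\<close>: this is how
  the measure of hypersurfaces enters.\<close>

definition bump :: "real^'n \<Rightarrow> real \<Rightarrow> real^'n \<Rightarrow> real"
  where "bump c r x = ramp (2 - (norm (x - c))\<^sup>2 / r\<^sup>2)"

lemma bump_bounds: "0 \<le> bump c r x" "bump c r x \<le> 1"
  unfolding bump_def by (rule ramp_bounds)+

lemma bump_eq_1:
  assumes "0 < r" "dist c x \<le> r" shows "bump c r x = 1"
  unfolding bump_def using assms
  by (intro ramp_eq_1) (simp add: field_simps dist_norm norm_minus_commute power_mono)

lemma bump_eq_0:
  assumes "0 < r" "x \<notin> cball c (2 * r)" shows "bump c r x = 0"
proof -
  have "(2 * r)\<^sup>2 \<le> (norm (x - c))\<^sup>2"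
    using assms by (intro power_mono) (auto simp: dist_norm norm_minus_commute)
  moreover have "2 * r\<^sup>2 \<le> (2 * r)\<^sup>2" by (simp add: power_mult_distrib)
  ultimately have "2 * r\<^sup>2 \<le> (norm (x - c))\<^sup>2" by linarith
  then show ?thesis unfolding bump_def using assms by (intro ramp_eq_0) (simp add: field_simps)
qed

lemma
  assumes r: "0 < r"
  shows C1_on_bump: "C1_on U (bump c r)"
    and norm_gradient_bump: "norm (gradient (bump c r) x) \<le> 8 / r * indicator (cball c (2 * r)) x"
proof -
  let ?d = "\<lambda>x. (- 2 * ramp' (2 - (norm (x - c))\<^sup>2 / r\<^sup>2) / r\<^sup>2) *\<^sub>R (x - c)"
  have D: "GDERIV (bump c r) x :> ?d x" for x
  proof -
    have "((\<lambda>x. 2 - k * ((x - c) \<bullet> (x - c))) has_derivative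
        (\<lambda>h. h \<bullet> ((- 2 * k) *\<^sub>R (x - c)))) (at x)" for k
      by (auto intro!: derivative_eq_intros simp: inner_commute)
    from this[of "1 / r\<^sup>2"] have "GDERIV (\<lambda>x. 2 - (norm (x - c))\<^sup>2 / r\<^sup>2) x :> (- 2 / r\<^sup>2) *\<^sub>R (x - c)"
      by (simp add: gderiv_def dot_square_norm)
    from GDERIV_DERIV_compose[OF this DERIV_ramp]
    show ?thesis by (simp add: bump_def[abs_def] mult.commute)
  qed
  show "C1_on U (bump c r)"
    by (rule C1_on_GDERIVI[OF D])
      (use r in \<open>auto intro!: continuous_intros continuous_on_compose2[OF continuous_ramp']\<close>)
  show "norm (gradient (bump c r) x) \<le> 8 / r * indicator (cball c (2 * r)) x"
  proof (cases "x \<in> cball c (2 * r)")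
    case True
    then have n: "norm (x - c) \<le> 2 * r" by (simp add: dist_norm norm_minus_commute)
    let ?q = "ramp' (2 - (norm (x - c))\<^sup>2 / r\<^sup>2)"
    have "norm (gradient (bump c r) x) = 2 / r\<^sup>2 * (?q * norm (x - c))"
      unfolding gradient_eq[OF D] using ramp'_bounds(1) by (simp add: abs_mult)
    also have "\<dots> \<le> 2 / r\<^sup>2 * (2 * (2 * r))"
      using n r ramp'_bounds by (intro mult_left_mono mult_mono) auto
    also have "\<dots> = 8 / r" using r by (simp add: power2_eq_square)
    finally show ?thesis using True by simp
  next
    case False
    have "(2 * r)\<^sup>2 \<le> (norm (x - c))\<^sup>2"
      using r False by (intro power_mono) (auto simp: dist_norm norm_minus_commute)
    moreover have "2 * r\<^sup>2 \<le> (2 * r)\<^sup>2" by (simp add: power_mult_distrib)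
    ultimately have "2 * r\<^sup>2 \<le> (norm (x - c))\<^sup>2" by linarith
    then have "ramp' (2 - (norm (x - c))\<^sup>2 / r\<^sup>2) = 0"
      using r by (intro ramp'_eq_0) (simp add: field_simps)
    then show ?thesis unfolding gradient_eq[OF D] using False by simp
  qed
qed

section \<open>The divergence inequality near a smooth boundary point\<close>

abbreviation supp :: "(real^'n \<Rightarrow> real) \<Rightarrow> (real^'n) set"
  where "supp \<phi> \<equiv> closure {x. \<phi> x \<noteq> 0}"

lemma outside_supp:
  assumes "x \<notin> supp \<phi>" shows "\<phi> x = 0" "gradient \<phi> x = 0"
proof -
  have 0: "\<phi> y = 0" if "y \<notin> supp \<phi>" for y
    using that closure_subset[of "{x. \<phi> x \<noteq> 0}"] by (meson mem_Collect_eq subsetD)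
  show "\<phi> x = 0" by (rule 0[OF assms])
  have "(\<phi> has_derivative (\<lambda>h. 0)) (at x)"
  proof (rule has_derivative_transform_within_open[of "\<lambda>x. 0"])
    show "open (- supp \<phi>)" "x \<in> - supp \<phi>" by (simp_all add: assms open_Compl)
    show "0 = \<phi> y" if "y \<in> - supp \<phi>" for y using 0[of y] that by simp
  qed simp
  then show "gradient \<phi> x = 0" by (intro gradient_eq) (simp add: gderiv_def)
qed

lemma supp_mult_subset: "supp (\<lambda>x. a x * b x) \<subseteq> supp a \<inter> supp b"
  by (intro Int_greatest closure_mono) auto

lemma bcont_C1:
  assumes "C1_on UNIV (\<phi> :: real^'n \<Rightarrow> real)" "bounded W"
  shows "bcont W \<phi>" "bcont W (gradient \<phi>)"
  by (rule bcont_bounded[OF C1_on_imp_continuous_on[OF assms(1)] assms(2)])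
    (rule bcont_bounded[OF C1_on_gradient_continuous[OF assms(1)] assms(2)])

text \<open>Near a smooth boundary point \<open>W\<close> is a sublevel set of \<open>g\<close>, and \<open>\<eta>\<close> cuts off the layer where \<open>g\<close> is
  close to \<open>0\<close>. The field \<open>\<phi> \<eta> V\<close> then has compact support inside \<open>W\<close>, so its divergence integrates to
  zero. The part of the divergence that falls on \<open>\<eta>\<close> is an approximate surface integral of the flux
  through the boundary, with the mass \<open>\<eta>'\<close> concentrated in the layer.\<close>

lemma ramp_cutoff_identity:
  fixes V :: "real^'n \<Rightarrow> real^'n"
  assumes U: "open U" "C1_on U g"
    and W: "open W" "bounded W" "W = {y \<in> U. g y < 0}"
    and \<phi>: "C1_on UNIV \<phi>" "supp \<phi> \<subseteq> B" "compact B" "B \<subseteq> U"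
    and \<epsilon>: "0 < \<epsilon>"
    and V: "C1_on W V" "bcont W V" "bcont W (divergence V)"
  defines "\<eta> \<equiv> \<lambda>y. ramp (- g y / \<epsilon> - 1)" and "\<eta>' \<equiv> \<lambda>y. ramp' (- g y / \<epsilon> - 1) / \<epsilon>"
  shows "bcont W \<eta>" "bcont W \<eta>'"
    and "set_integrable lborel W (\<lambda>y. \<phi> y * \<eta>' y * (V y \<bullet> gradient g y))"
    and "(LINT y:W|lborel. \<eta> y * (\<phi> y * divergence V y + V y \<bullet> gradient \<phi> y)) =
         (LINT y:W|lborel. \<phi> y * \<eta>' y * (V y \<bullet> gradient g y))"
proof -
  have gW: "C1_on W g" by (rule C1_on_subset[OF U(2)]) (simp add: W(3))
  have \<phi>W: "C1_on W \<phi>" using \<phi>(1) by (rule C1_on_subset) simp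
  have gc: "continuous_on W (\<lambda>y. - g y / \<epsilon> - 1)"
    using C1_on_imp_continuous_on[OF gW] \<epsilon> by (intro continuous_intros) auto
  have "((\<lambda>t. - t / \<epsilon> - 1) has_real_derivative - 1 / \<epsilon>) (at t)" for t
    using \<epsilon> by (auto intro!: derivative_eq_intros)
  note C1_on_compose_real[OF gW this continuous_on_const]
  then have "C1_on W (\<lambda>y. - g y / \<epsilon> - 1)"
    and grad1: "\<And>y. y \<in> W \<Longrightarrow> gradient (\<lambda>y. - g y / \<epsilon> - 1) y = (- 1 / \<epsilon>) *\<^sub>R gradient g y"
    by auto
  note c = C1_on_compose_real[OF this(1) DERIV_ramp continuous_ramp']
  have \<eta>: "C1_on W \<eta>" and grad_\<eta>: "\<And>y. y \<in> W \<Longrightarrow> gradient \<eta> y = - \<eta>' y *\<^sub>R gradient g y"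
    unfolding \<eta>_def \<eta>'_def using c grad1 by auto
  show b\<eta>: "bcont W \<eta>"
    unfolding bcont_def bounded_iff
    by (intro conjI C1_on_imp_continuous_on[OF \<eta>] exI[of _ 1]) (simp add: \<eta>_def ramp_bounds)
  show "bcont W \<eta>'"
    unfolding bcont_def
  proof
    show "continuous_on W \<eta>'" unfolding \<eta>'_def
      using continuous_on_compose2[OF continuous_ramp' gc] \<epsilon>
      by (intro continuous_on_divide continuous_on_const) auto
    have "\<bar>\<eta>' y\<bar> \<le> 2 / \<epsilon>" for y
      using ramp'_bounds \<epsilon> by (simp add: \<eta>'_def divide_right_mono)
    then show "bounded (\<eta>' ` W)" unfolding bounded_iff by (intro exI[of _ "2 / \<epsilon>"]) simp
  qed
  define T where "T = (\<lambda>y. (\<phi> y * \<eta> y) *\<^sub>R V y)"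
  have \<phi>\<eta>: "C1_on W (\<lambda>y. \<phi> y * \<eta> y)" by (rule C1_on_mult[OF \<phi>W \<eta>])
  define K where "K = {y \<in> B. g y \<le> - \<epsilon>}"
  have "continuous_on B g" using C1_on_imp_continuous_on[OF U(2)] \<phi>(4) continuous_on_subset by blast
  then have "closed K" unfolding K_def using compact_imp_closed[OF \<phi>(3)]
    by (intro continuous_on_closed_Collect_le continuous_intros)
  moreover have "B \<inter> K = K" by (auto simp: K_def)
  ultimately have K: "compact K" using compact_Int_closed[OF \<phi>(3)] by metis
  have KW: "K \<subseteq> W"
  proof
    fix y assume "y \<in> K"
    then have "y \<in> U" "g y < 0" using \<phi>(4) \<epsilon> by (auto simp: K_def)
    then show "y \<in> W" by (simp add: W(3))
  qed
  have TK: "T y = 0" if "y \<in> W - K" for y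
  proof (cases "y \<in> B")
    case True
    then have "- g y / \<epsilon> - 1 \<le> 0" using that \<epsilon> by (simp add: K_def field_simps)
    then show ?thesis by (simp add: T_def \<eta>_def ramp_eq_0)
  next
    case False
    then have "\<phi> y = 0" using outside_supp(1)[of y \<phi>] \<phi>(2) by blast
    then show ?thesis by (simp add: T_def)
  qed
  note I = integral_divergence_zero[OF W(1) C1_on_scaleR[OF \<phi>\<eta> V(1), folded T_def] K KW TK]
  have div_T: "divergence T y = \<eta> y * (\<phi> y * divergence V y + V y \<bullet> gradient \<phi> y)
      - \<phi> y * \<eta>' y * (V y \<bullet> gradient g y)" if "y \<in> W" for y
    unfolding T_def divergence_scaleR[OF \<phi>\<eta> V(1) that] gradient_mult[OF \<phi>W \<eta> that] grad_\<eta>[OF that]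
    by (simp add: inner_add_right algebra_simps)
  have i1: "set_integrable lborel W (\<lambda>y. \<eta> y * (\<phi> y * divergence V y + V y \<bullet> gradient \<phi> y))"
    using V b\<eta> bcont_C1[OF \<phi>(1) W(2)] W(1,2)
    by (intro set_integrable_bcont bcont_mult bcont_add bcont_inner) auto
  have eq: "\<phi> y * \<eta>' y * (V y \<bullet> gradient g y) =
      \<eta> y * (\<phi> y * divergence V y + V y \<bullet> gradient \<phi> y) - divergence T y" if "y \<in> W" for y
    using div_T[OF that] by simp
  show "set_integrable lborel W (\<lambda>y. \<phi> y * \<eta>' y * (V y \<bullet> gradient g y))"
    by (rule set_integrable_cong[OF refl refl eq, THEN iffD2]) (auto intro: set_integral_diff(1)[OF i1 I(1)])
  have "(LINT y:W|lborel. \<phi> y * \<eta>' y * (V y \<bullet> gradient g y)) =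
      (LINT y:W|lborel. \<eta> y * (\<phi> y * divergence V y + V y \<bullet> gradient \<phi> y) - divergence T y)"
    by (rule set_lebesgue_integral_cong) (use W(1) eq in \<open>simp, blast\<close>)
  then show "(LINT y:W|lborel. \<eta> y * (\<phi> y * divergence V y + V y \<bullet> gradient \<phi> y)) =
         (LINT y:W|lborel. \<phi> y * \<eta>' y * (V y \<bullet> gradient g y))"
    using set_integral_diff(2)[OF i1 I(1)] I(2) by simp
qed

text \<open>For a field with these properties the pairing with a test function \<open>\<phi>\<close>, defined below, is the integral of
  the divergence of \<open>\<phi> P\<close>, that is, the surface integral of \<open>\<phi>\<close> times the outward flux of \<open>P\<close> whenever a
  surface integral makes sense. Its sign is what matters here, and it is additive in \<open>\<phi>\<close>, so it can be
  determined locally and without a surface measure.\<close>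

locale flux_field =
  fixes \<Omega> :: "(real^'n) set" and P :: "real^'n \<Rightarrow> real^'n"
  assumes \<Omega>: "open \<Omega>" "bounded \<Omega>"
    and P: "continuous_on (closure \<Omega>) P" "C1_on \<Omega> P"
    and div_bounded: "bounded (divergence P ` \<Omega>)"
begin

definition pairing :: "(real^'n \<Rightarrow> real) \<Rightarrow> real"
  where "pairing \<phi> = (LINT x:\<Omega>|lborel. \<phi> x * divergence P x + P x \<bullet> gradient \<phi> x)"

lemma bcont_P: "bcont \<Omega> P"
  using P(1) \<Omega>(2) by (intro bcont_compact[of "closure \<Omega>"]) (auto simp: closure_subset)

lemma bcont_divergence: "bcont \<Omega> (divergence P)"
  unfolding bcont_def
proof
  show "continuous_on \<Omega> (divergence P)"
    using P(2) unfolding C1_on_def divergence_def[abs_def]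
    by (intro continuous_on_sum continuous_on_component) simp
qed (rule div_bounded)

lemma bcont_pairing:
  assumes "C1_on UNIV \<phi>"
  shows "bcont \<Omega> (\<lambda>x. \<phi> x * divergence P x + P x \<bullet> gradient \<phi> x)"
  using assms \<Omega>(2)
  by (intro bcont_add bcont_mult bcont_inner bcont_P bcont_divergence bcont_C1) auto

text \<open>This plays the role of a partition of unity: a bump function is split off a test function.\<close>

lemma pairing_split:
  assumes "C1_on UNIV \<phi>" "C1_on UNIV b"
  shows "pairing \<phi> = pairing (\<lambda>x. \<phi> x * b x) + pairing (\<lambda>x. \<phi> x * (1 - b x))"
proof -
  note i = set_integrable_bcont[OF bcont_pairing \<Omega>]
  note m = C1_on_mult[OF assms] C1_on_mult[OF assms(1) C1_on_one_minus[OF assms(2)]]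
  show ?thesis
    unfolding pairing_def set_integral_add(2)[OF i[OF m(1)] i[OF m(2)], symmetric]
  proof (rule set_lebesgue_integral_cong, use \<Omega> in simp, intro allI impI)
    fix x
    show "\<phi> x * divergence P x + P x \<bullet> gradient \<phi> x =
      \<phi> x * b x * divergence P x + P x \<bullet> gradient (\<lambda>x. \<phi> x * b x) x +
      (\<phi> x * (1 - b x) * divergence P x + P x \<bullet> gradient (\<lambda>x. \<phi> x * (1 - b x)) x)"
      unfolding gradient_mult[OF assms UNIV_I] gradient_one_minus[OF assms(2) UNIV_I]
        gradient_mult[OF assms(1) C1_on_one_minus[OF assms(2)] UNIV_I]
      by (simp add: inner_add_right algebra_simps)
  qed
qed

lemma pairing_interior:
  assumes "C1_on UNIV \<phi>" "supp \<phi> \<inter> frontier \<Omega> = {}"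
  shows "pairing \<phi> = 0"
proof -
  have \<phi>: "C1_on \<Omega> \<phi>" using assms(1) by (rule C1_on_subset) simp
  have K: "compact (supp \<phi> \<inter> closure \<Omega>)" using \<Omega>(2) by (intro closed_Int_compact) auto
  have sub: "supp \<phi> \<inter> closure \<Omega> \<subseteq> \<Omega>"
    using assms(2) \<Omega>(1) by (auto simp: frontier_def interior_open)
  have "(LINT x:\<Omega>|lborel. divergence (\<lambda>x. \<phi> x *\<^sub>R P x) x) = 0"
  proof (rule integral_divergence_zero(2)[OF \<Omega>(1) C1_on_scaleR[OF \<phi> P(2)] K sub])
    fix x assume "x \<in> \<Omega> - supp \<phi> \<inter> closure \<Omega>"
    then have "x \<notin> supp \<phi>" using closure_subset[of \<Omega>] by blast
    then show "\<phi> x *\<^sub>R P x = 0" using outside_supp(1)[of x \<phi>] by simp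
  qed
  then show ?thesis
    unfolding pairing_def using divergence_scaleR[OF \<phi> P(2)] \<Omega>(1)
    by (subst set_lebesgue_integral_cong) auto
qed

text \<open>In the cut-off identity for \<open>P\<close> the surface term is at least \<open>- \<delta>\<close> times the total mass of \<open>\<phi> \<eta>'\<close>, once
  the layer is so thin that the flux in it exceeds \<open>- \<delta>\<close>. The mass stays bounded as the layer shrinks: this
  is the same identity for the constant field \<open>w\<close>, the gradient of \<open>g\<close> at \<open>x0\<close>, whose flux is bounded below
  near \<open>x0\<close> while its other side does not involve the derivative of the ramp. Letting first the thickness
  of the layer and then \<open>\<delta>\<close> tend to zero gives the sign.\<close>

lemma pairing_nonneg_near_smooth_point:
  assumes U: "open U" "x0 \<in> U" "C1_on U g" "gradient g x0 \<noteq> 0" "\<Omega> \<inter> U = {y \<in> U. g y < 0}"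
    and flux: "\<And>y. y \<in> frontier \<Omega> \<inter> U \<Longrightarrow> 0 \<le> P y \<bullet> gradient g y"
  obtains r where "0 < r"
    "\<And>\<phi>. C1_on UNIV \<phi> \<Longrightarrow> (\<And>x. 0 \<le> \<phi> x) \<Longrightarrow> supp \<phi> \<subseteq> cball x0 (2 * r) \<Longrightarrow> 0 \<le> pairing \<phi>"
proof -
  \<comment> \<open>the constant test field that controls the mass of the boundary layer\<close>
  define w where "w = gradient g x0"
  define c where "c = (norm w)\<^sup>2 / 2"
  have c: "0 < c" using U(4) by (simp add: c_def w_def)
  have gc: "continuous_on U (\<lambda>y. w \<bullet> gradient g y)"
    by (intro continuous_intros C1_on_gradient_continuous U(3))
  have "open {y \<in> U. c < w \<bullet> gradient g y}"
    using continuous_open_preimage[OF gc U(1), of "{c<..}"] by (simp add: vimage_def Int_def)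
  moreover have "x0 \<in> {y \<in> U. c < w \<bullet> gradient g y}"
    using U(2,4) by (simp add: w_def[symmetric] c_def dot_square_norm)
  ultimately obtain e where e: "0 < e" "cball x0 e \<subseteq> {y \<in> U. c < w \<bullet> gradient g y}"
    by (meson open_contains_cball)
  define B where "B = cball x0 e"
  have B: "compact B" "B \<subseteq> U" "\<And>y. y \<in> B \<Longrightarrow> c < w \<bullet> gradient g y"
    using e by (auto simp: B_def)
  define W where "W = \<Omega> \<inter> U"
  have W: "open W" "bounded W" "W \<subseteq> U" "\<And>y. y \<in> U \<Longrightarrow> y \<in> W \<longleftrightarrow> g y < 0" "W \<subseteq> \<Omega>"
    using \<Omega> U(1,5) unfolding W_def by (blast intro: bounded_subset)+
  have WU: "W = {y \<in> U. g y < 0}" using U(5) by (simp add: W_def)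
  define \<eta> where "\<eta> \<epsilon> y = ramp (- g y / \<epsilon> - 1)" for \<epsilon> y
  define \<eta>' where "\<eta>' \<epsilon> y = ramp' (- g y / \<epsilon> - 1) / \<epsilon>" for \<epsilon> y
  have near: "\<exists>\<epsilon>0>0. \<forall>\<epsilon> y. 0 < \<epsilon> \<and> \<epsilon> < \<epsilon>0 \<and> y \<in> W \<and> y \<in> B \<and> \<eta>' \<epsilon> y \<noteq> 0 \<longrightarrow> - \<delta> \<le> P y \<bullet> gradient g y"
    if \<delta>: "0 < \<delta>" for \<delta>
  proof -
    \<comment> \<open>the points where the flux is too negative form a compact set away from the boundary\<close>
    define A where "A = {y \<in> B \<inter> closure \<Omega>. P y \<bullet> gradient g y \<le> - \<delta>}"
    have cB: "closed (B \<inter> closure \<Omega>)" using compact_imp_closed[OF B(1)] by blast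
    have "closed A" unfolding A_def
      by (intro continuous_on_closed_Collect_le cB continuous_intros
          continuous_on_subset[OF P(1)] continuous_on_subset[OF C1_on_gradient_continuous[OF U(3)]])
        (use B(2) in auto)
    moreover have "B \<inter> A = A" by (auto simp: A_def)
    ultimately have A: "compact A" using compact_Int_closed[OF B(1)] by metis
    have gA: "g y < 0" if "y \<in> A" for y
    proof -
      have y: "y \<in> U" "y \<in> closure \<Omega>" "P y \<bullet> gradient g y < 0"
        using that B(2) \<delta> by (auto simp: A_def)
      have "y \<in> \<Omega>" using flux[of y] y \<Omega>(1) by (force simp: frontier_def interior_open)
      then show ?thesis using W(4)[OF y(1)] y(1) by (simp add: W_def)
    qed
    have "\<exists>\<epsilon>0>0. \<forall>y\<in>A. g y \<le> - 2 * \<epsilon>0"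
    proof (cases "A = {}")
      case False
      have "continuous_on A g"
        by (rule continuous_on_subset[OF C1_on_imp_continuous_on[OF U(3)]]) (use B(2) in \<open>auto simp: A_def\<close>)
      from continuous_attains_sup[OF A False this] obtain z where "z \<in> A" "\<forall>y\<in>A. g y \<le> g z" by blast
      then show ?thesis using gA by (intro exI[of _ "- g z / 2"]) auto
    qed (auto intro: exI[of _ 1])
    then obtain \<epsilon>0 where \<epsilon>0: "0 < \<epsilon>0" "\<And>y. y \<in> A \<Longrightarrow> g y \<le> - 2 * \<epsilon>0" by auto
    have "- \<delta> \<le> P y \<bullet> gradient g y"
      if "0 < \<epsilon>" "\<epsilon> < \<epsilon>0" "y \<in> W" "y \<in> B" "\<eta>' \<epsilon> y \<noteq> 0" for \<epsilon> y
    proof (rule ccontr)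
      assume "\<not> ?thesis"
      then have "y \<in> A" using that closure_subset[of \<Omega>] by (auto simp: A_def W_def)
      then have "g y \<le> - 2 * \<epsilon>" using \<epsilon>0 that by fastforce
      then have "1 \<le> - g y / \<epsilon> - 1" using that by (simp add: field_simps)
      then show False using that ramp'_eq_0 by (simp add: \<eta>'_def)
    qed
    then show ?thesis using \<epsilon>0(1) by blast
  qed
  have main: "0 \<le> pairing \<phi>"
    if \<phi>: "C1_on UNIV \<phi>" "\<And>x. 0 \<le> \<phi> x" "supp \<phi> \<subseteq> B" for \<phi>
  proof -
    let ?q = "\<lambda>y. \<phi> y * divergence P y + P y \<bullet> gradient \<phi> y"
    note b\<phi> = bcont_C1[OF \<phi>(1) W(2)]
    have PW: "C1_on W P" "bcont W P" "bcont W (divergence P)"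
      using C1_on_subset[OF P(2) W(5)] bcont_subset[OF bcont_P W(5)] bcont_subset[OF bcont_divergence W(5)] by auto
    have dw: "divergence (\<lambda>y. w) = (\<lambda>y. 0)"
      by (auto simp: divergence_def partial_deriv_eq[OF has_derivative_const])
    have wW: "C1_on W (\<lambda>y. w)" "bcont W (\<lambda>y. w)" "bcont W (divergence (\<lambda>y. w))"
      unfolding dw by (auto intro: C1_on_const bcont_const)
    note idP = ramp_cutoff_identity[OF U(1,3) W(1,2) WU \<phi>(1,3) B(1,2) _ PW, folded \<eta>_def \<eta>'_def]
    note idw = ramp_cutoff_identity[OF U(1,3) W(1,2) WU \<phi>(1,3) B(1,2) _ wW, folded \<eta>_def \<eta>'_def, unfolded dw]
    have \<phi>0: "\<phi> y = 0" "gradient \<phi> y = 0" if "y \<notin> B" for y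
      using outside_supp[of y \<phi>] \<phi>(3) that by auto
    have \<eta>': "0 \<le> \<eta>' \<epsilon> y" if "0 < \<epsilon>" for \<epsilon> y
      using ramp'_bounds that by (simp add: \<eta>'_def)
    define M where "M = (LINT y:W|lborel. norm w * norm (gradient \<phi> y))"
    have iM: "set_integrable lborel W (\<lambda>y. norm w * norm (gradient \<phi> y))"
      by (intro set_integrable_bcont bcont_mult bcont_const bcont_norm b\<phi> W)
    have i\<eta>': "set_integrable lborel W (\<lambda>y. \<phi> y * \<eta>' \<epsilon> y)" if "0 < \<epsilon>" for \<epsilon>
      by (intro set_integrable_bcont bcont_mult b\<phi> W idP(2) that)
    have layer: "c * (LINT y:W|lborel. \<phi> y * \<eta>' \<epsilon> y) \<le> M" if \<epsilon>: "0 < \<epsilon>" for \<epsilon>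
    proof -
      have "c * (LINT y:W|lborel. \<phi> y * \<eta>' \<epsilon> y) = (LINT y:W|lborel. c * (\<phi> y * \<eta>' \<epsilon> y))" by simp
      also have "\<dots> \<le> (LINT y:W|lborel. \<phi> y * \<eta>' \<epsilon> y * (w \<bullet> gradient g y))"
      proof (rule set_integral_mono)
        show "c * (\<phi> y * \<eta>' \<epsilon> y) \<le> \<phi> y * \<eta>' \<epsilon> y * (w \<bullet> gradient g y)" for y
        proof (cases "y \<in> B")
          case True
          have "c * (\<phi> y * \<eta>' \<epsilon> y) \<le> (w \<bullet> gradient g y) * (\<phi> y * \<eta>' \<epsilon> y)"
            using B(3)[OF True] \<phi>(2) \<eta>'[OF \<epsilon>] by (intro mult_right_mono) auto
          then show ?thesis by (simp add: mult_ac)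
        qed (simp add: \<phi>0)
      qed (use i\<eta>'[OF \<epsilon>] idw(3)[OF \<epsilon>] in auto)
      also have "\<dots> = (LINT y:W|lborel. \<eta> \<epsilon> y * (\<phi> y * 0 + w \<bullet> gradient \<phi> y))"
        using idw(4)[OF \<epsilon>] by simp
      also have "\<dots> \<le> M" unfolding M_def
      proof (rule set_integral_mono)
        show "set_integrable lborel W (\<lambda>y. \<eta> \<epsilon> y * (\<phi> y * 0 + w \<bullet> gradient \<phi> y))"
          by (intro set_integrable_bcont bcont_mult bcont_add bcont_inner bcont_const b\<phi> W idP(1) \<epsilon>)
        show "\<eta> \<epsilon> y * (\<phi> y * 0 + w \<bullet> gradient \<phi> y) \<le> norm w * norm (gradient \<phi> y)" for y
        proof -
          have "\<eta> \<epsilon> y * (w \<bullet> gradient \<phi> y) \<le> \<eta> \<epsilon> y * (norm w * norm (gradient \<phi> y))"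
            by (intro mult_left_mono norm_cauchy_schwarz) (simp add: \<eta>_def ramp_bounds)
          also have "\<dots> \<le> 1 * (norm w * norm (gradient \<phi> y))"
            by (intro mult_right_mono) (auto simp: \<eta>_def ramp_bounds)
          finally show ?thesis by simp
        qed
      qed (rule iM)
      finally show ?thesis .
    qed
    have lim: "(\<lambda>n. LINT y:W|lborel. \<eta> (inverse (real (Suc n))) y * ?q y) \<longlonglongrightarrow> pairing \<phi>"
    proof -
      have q: "bcont W ?q" by (rule bcont_subset[OF bcont_pairing[OF \<phi>(1)] W(5)])
      have "(\<lambda>n. LINT y:W|lborel. \<eta> (inverse (real (Suc n))) y * ?q y) \<longlonglongrightarrow> (LINT y:W|lborel. ?q y)"
        unfolding set_lebesgue_integral_def
      proof (rule integral_dominated_convergence[where w = "\<lambda>y. indicator W y *\<^sub>R \<bar>?q y\<bar>"])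
        show "(\<lambda>y. indicator W y *\<^sub>R ?q y) \<in> borel_measurable lborel"
          using set_integrable_bcont[OF q W(1,2)] by (auto simp: set_integrable_def)
        show "(\<lambda>y. indicator W y *\<^sub>R (\<eta> (inverse (real (Suc n))) y * ?q y)) \<in> borel_measurable lborel" for n
          using set_integrable_bcont[OF bcont_mult[OF idP(1)[of "inverse (real (Suc n))"] q] W(1,2)]
          by (auto simp: set_integrable_def)
        show "integrable lborel (\<lambda>y. indicator W y *\<^sub>R \<bar>?q y\<bar>)"
          using set_integrable_abs[OF set_integrable_bcont[OF q W(1,2)]] by (simp add: set_integrable_def)
        show "AE y in lborel. norm (indicator W y *\<^sub>R (\<eta> (inverse (real (Suc n))) y * ?q y))
            \<le> indicator W y *\<^sub>R \<bar>?q y\<bar>" for n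
          by (intro AE_I2) (auto simp: abs_mult \<eta>_def ramp_bounds abs_of_nonneg intro!: mult_left_mono mult_left_le_one_le)
        show "AE y in lborel. (\<lambda>n. indicator W y *\<^sub>R (\<eta> (inverse (real (Suc n))) y * ?q y))
            \<longlonglongrightarrow> indicator W y *\<^sub>R ?q y"
        proof (intro AE_I2)
          fix y
          show "(\<lambda>n. indicator W y *\<^sub>R (\<eta> (inverse (real (Suc n))) y * ?q y)) \<longlonglongrightarrow> indicator W y *\<^sub>R ?q y"
          proof (cases "y \<in> W")
            case True
            \<comment> \<open>the ramp equals 1 at depth 2 eps, hence eventually at every interior point\<close>
            then have g: "g y < 0" using W(3,4) by blast
            obtain N where N: "2 / (- g y) \<le> real N" using real_arch_simple by blast
            have "\<eta> (inverse (real (Suc n))) y = 1" if "N \<le> n" for n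
            proof -
              have "2 / (- g y) \<le> real (Suc n)" using N that by linarith
              moreover have "0 < - g y" using g by simp
              ultimately have "2 \<le> real (Suc n) * (- g y)" by (metis pos_divide_le_eq)
              then show ?thesis by (simp add: \<eta>_def ramp_eq_1 divide_inverse mult.commute del: of_nat_Suc)
            qed
            then have "\<forall>\<^sub>F n in sequentially. indicator W y *\<^sub>R (\<eta> (inverse (real (Suc n))) y * ?q y)
                = indicator W y *\<^sub>R ?q y"
              by (intro eventually_sequentiallyI[of N]) simp
            then show ?thesis by (rule tendsto_eventually)
          qed simp
        qed
      qed
      moreover have "?q y = 0" if "y \<notin> U" for y
      proof -
        have "y \<notin> B" using B(2) that by blast
        then show ?thesis by (simp add: \<phi>0)
      qed
      then have "(LINT y:W|lborel. ?q y) = pairing \<phi>"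
        unfolding pairing_def set_lebesgue_integral_def
        by (intro Bochner_Integration.integral_cong) (auto simp: W_def indicator_def)
      ultimately show ?thesis by simp
    qed
    have "- (\<delta> * M / c) \<le> pairing \<phi>" if \<delta>: "0 < \<delta>" for \<delta>
    proof -
      from near[OF \<delta>] obtain \<epsilon>0 where \<epsilon>0: "0 < \<epsilon>0"
        "\<And>\<epsilon> y. 0 < \<epsilon> \<Longrightarrow> \<epsilon> < \<epsilon>0 \<Longrightarrow> y \<in> W \<Longrightarrow> y \<in> B \<Longrightarrow> \<eta>' \<epsilon> y \<noteq> 0 \<Longrightarrow> - \<delta> \<le> P y \<bullet> gradient g y"
        by blast
      have "- (\<delta> * M / c) \<le> (LINT y:W|lborel. \<eta> \<epsilon> y * ?q y)" if \<epsilon>: "0 < \<epsilon>" "\<epsilon> < \<epsilon>0" for \<epsilon>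
      proof -
        have "\<delta> * (LINT y:W|lborel. \<phi> y * \<eta>' \<epsilon> y) \<le> \<delta> * (M / c)"
          using layer[OF \<epsilon>(1)] c \<delta> by (intro mult_left_mono) (auto simp: field_simps)
        then have "- (\<delta> * M / c) \<le> - \<delta> * (LINT y:W|lborel. \<phi> y * \<eta>' \<epsilon> y)"
          by simp
        also have "\<dots> = (LINT y:W|lborel. - \<delta> * (\<phi> y * \<eta>' \<epsilon> y))"
          by (simp only: set_integral_mult_right)
        also have "\<dots> \<le> (LINT y:W|lborel. \<phi> y * \<eta>' \<epsilon> y * (P y \<bullet> gradient g y))"
        proof (rule set_integral_mono)
          fix y assume y: "y \<in> W"
          show "- \<delta> * (\<phi> y * \<eta>' \<epsilon> y) \<le> \<phi> y * \<eta>' \<epsilon> y * (P y \<bullet> gradient g y)"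
          proof (cases "y \<in> B \<and> \<eta>' \<epsilon> y \<noteq> 0")
            case True
            have "- \<delta> * (\<phi> y * \<eta>' \<epsilon> y) \<le> (P y \<bullet> gradient g y) * (\<phi> y * \<eta>' \<epsilon> y)"
              using \<epsilon>0(2)[OF \<epsilon> y] True \<phi>(2) \<eta>'[OF \<epsilon>(1)] by (intro mult_right_mono) auto
            then show ?thesis by (simp add: mult_ac)
          qed (use \<phi>0 in auto)
        qed (intro set_integrable_mult_right i\<eta>'[OF \<epsilon>(1)] idP(3)[OF \<epsilon>(1)])+
        also have "\<dots> = (LINT y:W|lborel. \<eta> \<epsilon> y * ?q y)" using idP(4)[OF \<epsilon>(1)] by simp
        finally show ?thesis .
      qed
      moreover have "\<forall>\<^sub>F n in sequentially. inverse (real (Suc n)) < \<epsilon>0"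
        using LIMSEQ_inverse_real_of_nat \<epsilon>0(1) by (rule order_tendstoD(2))
      ultimately have "\<forall>\<^sub>F n in sequentially.
          - (\<delta> * M / c) \<le> (LINT y:W|lborel. \<eta> (inverse (real (Suc n))) y * ?q y)"
        by (auto elim!: eventually_mono)
      then show ?thesis using lim by (intro tendsto_lowerbound[OF lim]) auto
    qed
    note bound = this
    have "((\<lambda>\<delta>. - (\<delta> * M / c)) \<longlongrightarrow> - (0 * M / c)) (at_right 0)"
      using c by (intro tendsto_intros) auto
    moreover have "\<forall>\<^sub>F \<delta> in at_right 0. - (\<delta> * M / c) \<le> pairing \<phi>"
      using eventually_at_right_less[of 0] by (rule eventually_mono) (rule bound)
    ultimately have "- (0 * M / c) \<le> pairing \<phi>"
      by (rule tendsto_upperbound) simp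
    then show ?thesis by simp
  qed
  show ?thesis
    by (rule that[of "e / 2"]) (use e(1) main in \<open>auto simp: B_def\<close>)
qed

end

section \<open>The divergence inequality on piecewise smooth domains\<close>

text \<open>Where a defining function has a non-vanishing gradient at one boundary point it serves all nearby boundary
  points as well. Hence the set of boundary points with a normal is relatively open.\<close>

lemma outward_unit_normal_neighbourhood:
  assumes "outward_unit_normal \<Omega> x \<nu>" "open \<Omega>"
  obtains U g where "open U" "x \<in> U" "C1_on U g" "\<And>y. y \<in> U \<Longrightarrow> gradient g y \<noteq> 0"
    "\<Omega> \<inter> U = {y \<in> U. g y < 0}" "\<nu> = gradient g x /\<^sub>R norm (gradient g x)"
    "\<And>y. y \<in> frontier \<Omega> \<inter> U \<Longrightarrow> g y = 0"
    "\<And>y. y \<in> frontier \<Omega> \<inter> U \<Longrightarrow> outward_unit_normal \<Omega> y (gradient g y /\<^sub>R norm (gradient g y))"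
proof -
  from assms(1) obtain U0 g where U0: "open U0" "x \<in> U0" "C1_on U0 g" "gradient g x \<noteq> 0"
    "\<Omega> \<inter> U0 = {y \<in> U0. g y < 0}" "\<nu> = gradient g x /\<^sub>R norm (gradient g x)"
    unfolding outward_unit_normal_def by blast
  define U where "U = {y \<in> U0. gradient g y \<noteq> 0}"
  have oU: "open U"
    using continuous_open_preimage[OF C1_on_gradient_continuous[OF U0(3)] U0(1) open_Compl[OF closed_singleton]]
    by (simp add: U_def vimage_def Int_def)
  have xU: "x \<in> U" using U0 by (simp add: U_def)
  have gU: "C1_on U g" using U0(3) by (rule C1_on_subset) (auto simp: U_def)
  have \<Omega>U: "\<Omega> \<inter> U = {y \<in> U. g y < 0}" using U0(5) by (auto simp: U_def)
  have g0: "g y = 0" if "y \<in> frontier \<Omega> \<inter> U" for y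
  proof -
    have y: "y \<in> U" "y \<in> closure \<Omega>" "y \<notin> \<Omega>"
      using that assms(2) by (auto simp: frontier_def interior_open)
    have "\<not> 0 < g y"
    proof
      assume "0 < g y"
      define O' where "O' = {z \<in> U. 0 < g z}"
      have "open O'"
        using continuous_open_preimage[OF C1_on_imp_continuous_on[OF gU] oU, of "{0<..}"]
        by (simp add: O'_def vimage_def Int_def)
      moreover have "y \<in> O'" using y \<open>0 < g y\<close> by (simp add: O'_def)
      ultimately have "O' \<inter> \<Omega> \<noteq> {}"
        using y(2) open_Int_closure_eq_empty[of O' \<Omega>] by blast
      then show False using \<Omega>U by (force simp: O'_def)
    qed
    moreover have "\<not> g y < 0" using y \<Omega>U by blast
    ultimately show ?thesis by simp
  qed
  have grad: "gradient g y \<noteq> 0" if "y \<in> U" for y using that by (simp add: U_def)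
  have "outward_unit_normal \<Omega> y (gradient g y /\<^sub>R norm (gradient g y))"
    if "y \<in> frontier \<Omega> \<inter> U" for y
    unfolding outward_unit_normal_def
    using that by (intro exI[of _ U] exI[of _ g] conjI oU gU \<Omega>U g0 grad refl) simp_all
  then show ?thesis using that[OF oU xU gU grad \<Omega>U U0(6) g0] by blast
qed

text \<open>A product of such factors vanishes where some \<open>b m\<close> equals \<open>1\<close>. Its deviation from \<open>1\<close> and its gradient are
  controlled by the sums over \<open>m\<close>, independently of how the supports overlap.\<close>

lemma prod_cutoff:
  assumes "finite J" "\<And>m. m \<in> J \<Longrightarrow> C1_on UNIV (b m)" "\<And>m x. 0 \<le> b m x" "\<And>m x. b m x \<le> 1"
  defines "\<phi> \<equiv> \<lambda>x :: real^'n. \<Prod>m\<in>J. 1 - b m x :: real"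
  shows "C1_on UNIV \<phi>" "0 \<le> \<phi> x" "\<phi> x \<le> 1" "1 - \<phi> x \<le> (\<Sum>m\<in>J. b m x)"
    "norm (gradient \<phi> x) \<le> (\<Sum>m\<in>J. norm (gradient (b m) x))"
proof -
  have bnd: "0 \<le> (\<Prod>m\<in>J'. 1 - b m x)" "(\<Prod>m\<in>J'. 1 - b m x) \<le> 1" for J' x
    using assms(3,4) by (auto intro!: prod_nonneg prod_le_1)
  then show "0 \<le> \<phi> x" "\<phi> x \<le> 1" by (auto simp: \<phi>_def)
  have "C1_on UNIV \<phi> \<and> 1 - \<phi> x \<le> (\<Sum>m\<in>J. b m x) \<and>
      norm (gradient \<phi> x) \<le> (\<Sum>m\<in>J. norm (gradient (b m) x))"
    unfolding \<phi>_def using assms(1,2)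
  proof (induction J)
    case empty
    have "gradient (\<lambda>x :: real^'n. 1) x = 0" by (rule gradient_eq[OF GDERIV_const])
    then show ?case by (simp add: C1_on_const)
  next
    case (insert k J)
    let ?p = "\<lambda>x. \<Prod>m\<in>J. 1 - b m x"
    have IH: "C1_on UNIV ?p" "1 - ?p x \<le> (\<Sum>m\<in>J. b m x)"
      "norm (gradient ?p x) \<le> (\<Sum>m\<in>J. norm (gradient (b m) x))" and k: "C1_on UNIV (b k)"
      using insert by auto
    have eq: "(\<lambda>x. \<Prod>m\<in>insert k J. 1 - b m x) = (\<lambda>x. (1 - b k x) * ?p x)"
      using insert(1,2) by simp
    have "gradient (\<lambda>x. (1 - b k x) * ?p x) x = (1 - b k x) *\<^sub>R gradient ?p x - ?p x *\<^sub>R gradient (b k) x"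
      unfolding gradient_mult[OF C1_on_one_minus[OF k] IH(1) UNIV_I] gradient_one_minus[OF k UNIV_I] by simp
    then have "norm (gradient (\<lambda>x. (1 - b k x) * ?p x) x)
        \<le> norm ((1 - b k x) *\<^sub>R gradient ?p x) + norm (?p x *\<^sub>R gradient (b k) x)"
      by (simp only: norm_triangle_ineq4)
    also have "\<dots> \<le> norm (gradient ?p x) + norm (gradient (b k) x)"
      using bnd[where J' = J and x = x] assms(3,4) by (intro add_mono) (auto intro!: mult_left_le_one_le)
    finally have "norm (gradient (\<lambda>x. (1 - b k x) * ?p x) x)
        \<le> norm (gradient (b k) x) + (\<Sum>m\<in>J. norm (gradient (b m) x))" using IH(3) by linarith
    moreover have "b k x * ?p x \<le> b k x"
      using bnd[where J' = J and x = x] assms(3) by (intro mult_left_le) auto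
    then have "1 - (1 - b k x) * ?p x \<le> b k x + (\<Sum>m\<in>J. b m x)"
      using IH(2) by (simp add: algebra_simps)
    ultimately show ?case
      unfolding eq using insert(1,2) by (auto intro: C1_on_mult[OF C1_on_one_minus[OF k] IH(1)])
  qed
  then show "C1_on UNIV \<phi>" "1 - \<phi> x \<le> (\<Sum>m\<in>J. b m x)"
    "norm (gradient \<phi> x) \<le> (\<Sum>m\<in>J. norm (gradient (b m) x))" by auto
qed

lemma closed_irregular_boundary:
  assumes "open \<Omega>"
  shows "closed {x \<in> frontier \<Omega>. \<nexists>\<nu>. outward_unit_normal \<Omega> x \<nu>}" (is "closed ?S")
proof -
  have "\<exists>T. open T \<and> z \<in> T \<and> T \<subseteq> - ?S" if z: "z \<in> - ?S" for z
  proof (cases "z \<in> frontier \<Omega>")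
    case True
    then obtain \<nu> where "outward_unit_normal \<Omega> z \<nu>" using z by blast
    from outward_unit_normal_neighbourhood[OF this assms] obtain U g where
      "open U" "z \<in> U" "\<And>y. y \<in> frontier \<Omega> \<inter> U \<Longrightarrow>
        outward_unit_normal \<Omega> y (gradient g y /\<^sub>R norm (gradient g y))" by metis
    then show ?thesis by (intro exI[of _ U]) auto
  next
    case False
    then show ?thesis
      by (intro exI[of _ "- frontier \<Omega>"]) (auto intro: open_Compl[OF frontier_closed])
  qed
  then have "open (- ?S)" using open_subopen by blast
  then show ?thesis by (simp only: closed_def)
qed

context flux_field
begin

text \<open>The conclusion of the local lemma in a form that allows choosing a radius at every smooth boundary point.\<close>

definition absorbing_ball :: "real^'n \<Rightarrow> real \<Rightarrow> bool"
  where "absorbing_ball c r \<longleftrightarrow> 0 < r \<and>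
    (\<forall>\<phi>. C1_on UNIV \<phi> \<longrightarrow> (\<forall>x. 0 \<le> \<phi> x) \<longrightarrow> supp \<phi> \<subseteq> cball c (2 * r) \<longrightarrow> 0 \<le> pairing \<phi>)"

text \<open>By induction on the cover: the part \<open>\<phi> b\<close> is supported in the ball removed, and the remainder
  \<open>\<phi> (1 - b)\<close> avoids it. When no ball is left the support stays away from the boundary and the pairing
  vanishes.\<close>

lemma pairing_nonneg_cover:
  assumes "finite I" "\<And>c. c \<in> I \<Longrightarrow> absorbing_ball c (r c)"
    and "C1_on UNIV \<phi>" "\<And>x. 0 \<le> \<phi> x" "supp \<phi> \<inter> frontier \<Omega> \<subseteq> (\<Union>c\<in>I. ball c (r c))"
  shows "0 \<le> pairing \<phi>"
  using assms
proof (induction I arbitrary: \<phi>)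
  case empty
  then show ?case using pairing_interior[of \<phi>] by simp
next
  case (insert c I)
  let ?b = "bump c (r c)"
  have r: "0 < r c" using insert.prems(1) by (simp add: absorbing_ball_def)
  have b: "C1_on UNIV ?b" by (rule C1_on_bump[OF r])
  have "supp ?b \<subseteq> cball c (2 * r c)"
  proof (rule closure_minimal)
    show "{x. ?b x \<noteq> 0} \<subseteq> cball c (2 * r c)" using bump_eq_0[OF r, of _ c] by blast
  qed simp
  then have "supp (\<lambda>x. \<phi> x * ?b x) \<subseteq> cball c (2 * r c)"
    using supp_mult_subset[of \<phi> ?b] by blast
  moreover have "C1_on UNIV (\<lambda>x. \<phi> x * ?b x)" by (rule C1_on_mult[OF insert.prems(2) b])
  moreover have "0 \<le> \<phi> x * ?b x" for x
    by (intro mult_nonneg_nonneg insert.prems(3) bump_bounds(1))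
  ultimately have 1: "0 \<le> pairing (\<lambda>x. \<phi> x * ?b x)"
    using insert.prems(1)[of c] unfolding absorbing_ball_def by blast
  have "supp (\<lambda>x. 1 - ?b x) \<subseteq> - ball c (r c)"
  proof (rule closure_minimal)
    have "?b x = 1" if "x \<in> ball c (r c)" for x
      using that by (intro bump_eq_1[OF r]) simp
    then show "{x. 1 - ?b x \<noteq> 0} \<subseteq> - ball c (r c)" by auto
  qed (simp add: closed_Compl)
  then have sub: "supp (\<lambda>x. \<phi> x * (1 - ?b x)) \<subseteq> supp \<phi> - ball c (r c)"
    using supp_mult_subset[of \<phi> "\<lambda>x. 1 - ?b x"] by blast
  have 2: "0 \<le> pairing (\<lambda>x. \<phi> x * (1 - ?b x))"
  proof (rule insert.IH)
    show "supp (\<lambda>x. \<phi> x * (1 - ?b x)) \<inter> frontier \<Omega> \<subseteq> (\<Union>c\<in>I. ball c (r c))"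
      using sub insert.prems(4) by blast
    show "C1_on UNIV (\<lambda>x. \<phi> x * (1 - ?b x))"
      by (rule C1_on_mult[OF insert.prems(2) C1_on_one_minus[OF b]])
    show "0 \<le> \<phi> x * (1 - ?b x)" for x using insert.prems(3)[of x] bump_bounds(2)[of c "r c" x] by simp
  qed (use insert.prems(1) in auto)
  show ?case unfolding pairing_split[OF insert.prems(2) b] using 1 2 by simp
qed

lemma pairing_nonneg_regular:
  assumes flux: "\<And>x \<nu>. x \<in> frontier \<Omega> \<Longrightarrow> outward_unit_normal \<Omega> x \<nu> \<Longrightarrow> 0 \<le> P x \<bullet> \<nu>"
    and \<phi>: "C1_on UNIV \<phi>" "\<And>x. 0 \<le> \<phi> x"
      "supp \<phi> \<inter> frontier \<Omega> \<subseteq> {x. \<exists>\<nu>. outward_unit_normal \<Omega> x \<nu>}"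
  shows "0 \<le> pairing \<phi>"
proof -
  define K where "K = supp \<phi> \<inter> frontier \<Omega>"
  have K: "compact K" unfolding K_def using \<Omega>(2)
    by (intro closed_Int_compact compact_frontier_bounded) auto
  have "\<exists>r. absorbing_ball x r" if x: "x \<in> K" for x
  proof -
    obtain \<nu> where \<nu>: "outward_unit_normal \<Omega> x \<nu>" using x \<phi>(3) by (auto simp: K_def)
    show ?thesis
    proof (rule outward_unit_normal_neighbourhood[OF \<nu> \<Omega>(1)])
      fix U g assume U: "open U" "x \<in> U" "C1_on U g" "\<And>y. y \<in> U \<Longrightarrow> gradient g y \<noteq> 0"
        "\<Omega> \<inter> U = {y \<in> U. g y < 0}" "\<nu> = gradient g x /\<^sub>R norm (gradient g x)"
        "\<And>y. y \<in> frontier \<Omega> \<inter> U \<Longrightarrow> g y = 0"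
        "\<And>y. y \<in> frontier \<Omega> \<inter> U \<Longrightarrow> outward_unit_normal \<Omega> y (gradient g y /\<^sub>R norm (gradient g y))"
      have flux': "0 \<le> P y \<bullet> gradient g y" if "y \<in> frontier \<Omega> \<inter> U" for y
      proof -
        have "0 \<le> P y \<bullet> (gradient g y /\<^sub>R norm (gradient g y))"
          using flux U(8)[OF that] that by blast
        moreover have "0 < norm (gradient g y)" using U(4) that by simp
        ultimately show ?thesis by (simp add: zero_le_mult_iff)
      qed
      show ?thesis
      proof (rule pairing_nonneg_near_smooth_point[OF U(1-3) U(4)[OF U(2)] U(5) flux'])
        fix r :: real
        assume "0 < r" "\<And>\<phi>. C1_on UNIV \<phi> \<Longrightarrow> (\<And>x. 0 \<le> \<phi> x) \<Longrightarrow>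
          supp \<phi> \<subseteq> cball x (2 * r) \<Longrightarrow> 0 \<le> pairing \<phi>"
        then show ?thesis by (intro exI[of _ r]) (simp add: absorbing_ball_def)
      qed
    qed
  qed
  then obtain r where r: "\<And>x. x \<in> K \<Longrightarrow> absorbing_ball x (r x)" by metis
  have "K \<subseteq> (\<Union>x\<in>K. ball x (r x))" using r by (force simp: absorbing_ball_def)
  then obtain I where I: "I \<subseteq> K" "finite I" "K \<subseteq> (\<Union>x\<in>I. ball x (r x))"
    using compactE_image[OF K, of K "\<lambda>x. ball x (r x)"] by auto
  show ?thesis
    by (rule pairing_nonneg_cover[OF I(2) _ \<phi>(1,2)]) (use I r in \<open>auto simp: K_def\<close>)
qed

text \<open>The boundary points without a normal form a compact set, which finitely many balls
  with a small sum of \<open>r ^ (n - 1)\<close> cover. The product \<open>\<phi>\<close> of the complementary bumps vanishes on these balls, so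
  its pairing is nonnegative; and replacing \<open>\<phi>\<close> by \<open>1\<close> costs at most a constant times that sum.\<close>

theorem integral_divergence_nonneg:
  assumes dim: "CARD('n) \<ge> 2" and smooth: "piecewise_smooth_boundary \<Omega>"
    and flux: "\<And>x \<nu>. x \<in> frontier \<Omega> \<Longrightarrow> outward_unit_normal \<Omega> x \<nu> \<Longrightarrow> 0 \<le> P x \<bullet> \<nu>"
  shows "0 \<le> (LINT x:\<Omega>|lborel. divergence P x)"
proof -
  define S where "S = {x \<in> frontier \<Omega>. \<nexists>\<nu>. outward_unit_normal \<Omega> x \<nu>}"
  define n where "n = CARD('n)"
  have S: "compact S"
    using compact_Int_closed[OF compact_frontier_bounded[OF \<Omega>(2)] closed_irregular_boundary[OF \<Omega>(1)]]
    unfolding S_def by (simp add: Int_def)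
  obtain M1 M2 where M12: "\<And>x. x \<in> \<Omega> \<Longrightarrow> norm (P x) \<le> M1" "\<And>x. x \<in> \<Omega> \<Longrightarrow> \<bar>divergence P x\<bar> \<le> M2"
    using bcont_P bcont_divergence by (auto simp: bcont_def bounded_iff)
  define M where "M = max 0 (max M1 M2)"
  have M: "0 \<le> M" "\<And>x. x \<in> \<Omega> \<Longrightarrow> norm (P x) \<le> M" "\<And>x. x \<in> \<Omega> \<Longrightarrow> \<bar>divergence P x\<bar> \<le> M"
    using M12 by (auto simp: M_def le_max_iff_disj)
  define k where "k = M * (9 * 2 ^ n * unit_ball_vol (real n))"
  note iD = set_integrable_bcont[OF bcont_divergence \<Omega>]
  have main: "- (k * \<epsilon>) \<le> (LINT x:\<Omega>|lborel. divergence P x)" if \<epsilon>: "0 < \<epsilon>" "\<epsilon> < 1" for \<epsilon>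
  proof -
    have "hypersurface_null S" using smooth by (simp add: piecewise_smooth_boundary_def S_def)
    then have "\<exists>c r. (\<forall>m. 0 < r m) \<and> S \<subseteq> (\<Union>m. ball (c m) (r m)) \<and>
        summable (\<lambda>m. r m ^ (n - 1)) \<and> (\<Sum>m. r m ^ (n - 1)) < \<epsilon>"
      using \<epsilon>(1) unfolding hypersurface_null_def n_def by (elim allE[of _ \<epsilon>]) simp
    then obtain c r where r: "\<forall>m. 0 < r m" and cr': "S \<subseteq> (\<Union>m. ball (c m) (r m))"
      "summable (\<lambda>m. r m ^ (n - 1))" "(\<Sum>m. r m ^ (n - 1)) < \<epsilon>"
      by (elim exE conjE)
    note cr = r[rule_format] cr'
    obtain J where J: "finite J" "S \<subseteq> (\<Union>m\<in>J. ball (c m) (r m))"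
      using compactE_image[OF S, of UNIV "\<lambda>m. ball (c m) (r m)"] cr(2) by auto
    have sumJ: "(\<Sum>m\<in>J'. r m ^ (n - 1)) < \<epsilon>" if "finite J'" for J'
      using sum_le_suminf[OF cr(3) that] cr(1,4) by (force simp: less_imp_le)
    \<comment> \<open>here n - 1 is positive, so a small power means a small radius\<close>
    have r1: "r m < 1" for m
    proof (rule ccontr)
      assume "\<not> r m < 1"
      then have "1 \<le> r m ^ (n - 1)" by (intro one_le_power) simp
      then show False using sumJ[of "{m}"] \<epsilon>(2) by simp
    qed
    define b where "b m = bump (c m) (r m)" for m
    define \<phi> where "\<phi> x = (\<Prod>m\<in>J. 1 - b m x)" for x
    have b: "C1_on UNIV (b m)" "0 \<le> b m x" "b m x \<le> 1" for m x
      unfolding b_def using C1_on_bump cr(1) bump_bounds by auto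
    have \<phi>: "C1_on UNIV \<phi>" "0 \<le> \<phi> x" "\<phi> x \<le> 1" "1 - \<phi> x \<le> (\<Sum>m\<in>J. b m x)"
      "norm (gradient \<phi> x) \<le> (\<Sum>m\<in>J. norm (gradient (b m) x))" for x
      unfolding \<phi>_def[abs_def] by (rule prod_cutoff[where b = b, OF J(1) b])+
    have "0 \<le> pairing \<phi>"
    proof (rule pairing_nonneg_regular[OF flux \<phi>(1,2)])
      show "supp \<phi> \<inter> frontier \<Omega> \<subseteq> {x. \<exists>\<nu>. outward_unit_normal \<Omega> x \<nu>}"
      proof
        fix x assume x: "x \<in> supp \<phi> \<inter> frontier \<Omega>"
        have "supp \<phi> \<subseteq> - (\<Union>m\<in>J. ball (c m) (r m))"
        proof (rule closure_minimal)
          have "\<phi> y = 0" if "m \<in> J" "dist (c m) y < r m" for m y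
          proof -
            have "b m y = 1" using bump_eq_1[OF cr(1), of "c m" y m] that(2) by (simp add: b_def)
            then show ?thesis using J(1) that(1) unfolding \<phi>_def by (intro prod_zero) auto
          qed
          then show "{x. \<phi> x \<noteq> 0} \<subseteq> - (\<Union>m\<in>J. ball (c m) (r m))" by auto
          show "closed (- (\<Union>m\<in>J. ball (c m) (r m)))" by (intro closed_Compl open_UN) simp
        qed
        then have "x \<notin> S" using x J(2) by blast
        then show "x \<in> {x. \<exists>\<nu>. outward_unit_normal \<Omega> x \<nu>}" using x by (simp add: S_def)
      qed
    qed
    define e where "e x = (\<Sum>m\<in>J. M * (9 / r m) * indicator (cball (c m) (2 * r m)) x)" for x
    have ball_fin: "emeasure lborel (cball (c m) (2 * r m)) < \<infinity>" for m
      by (rule emeasure_compact_finite) simp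
    have ie: "integrable lborel e"
      unfolding e_def using ball_fin
      by (intro Bochner_Integration.integrable_sum integrable_mult_right integrable_real_indicator) auto
    have e0: "0 \<le> e x" for x
      unfolding e_def using M(1) cr(1) by (auto intro!: sum_nonneg mult_nonneg_nonneg simp: less_imp_le)
    have "integral\<^sup>L lborel e = (\<Sum>m\<in>J. M * (9 / r m) * measure lborel (cball (c m) (2 * r m)))"
      unfolding e_def using ball_fin
      by (subst Bochner_Integration.integral_sum)
        (auto intro!: integrable_mult_right integrable_real_indicator)
    also have "\<dots> = (\<Sum>m\<in>J. k * r m ^ (n - 1))"
    proof (rule sum.cong)
      fix m
      have "measure lborel (cball (c m) (2 * r m)) = unit_ball_vol (real n) * (2 * r m) ^ n"
        using content_cball[of "2 * r m" "c m"] cr(1)[of m] by (simp add: n_def less_imp_le)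
      moreover have "r m ^ n = r m * r m ^ (n - 1)"
        using dim by (simp add: n_def power_eq_if)
      \<comment> \<open>one of the n factors r m is absorbed by the gradient bound 1 / r m\<close>
      ultimately show "M * (9 / r m) * measure lborel (cball (c m) (2 * r m)) = k * r m ^ (n - 1)"
        using cr(1)[of m] by (simp add: k_def power_mult_distrib)
    qed simp
    also have "\<dots> = k * (\<Sum>m\<in>J. r m ^ (n - 1))" by (simp add: sum_distrib_left)
    also have "\<dots> \<le> k * \<epsilon>"
      using sumJ[OF J(1)] M(1) by (intro mult_left_mono) (auto simp: k_def)
    finally have eb: "integral\<^sup>L lborel e \<le> k * \<epsilon>" .
    have ie\<Omega>: "set_integrable lborel \<Omega> e"
      using ie \<Omega>(1) unfolding set_integrable_def by (intro integrable_mult_indicator) auto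
    have "(LINT x:\<Omega>|lborel. e x) \<le> integral\<^sup>L lborel e"
      unfolding set_lebesgue_integral_def using ie ie\<Omega> e0
      by (intro integral_mono) (auto simp: set_integrable_def indicator_def)
    have "0 \<le> (LINT x:\<Omega>|lborel. \<phi> x * divergence P x + P x \<bullet> gradient \<phi> x)"
      using \<open>0 \<le> pairing \<phi>\<close> by (simp add: pairing_def)
    also have "\<dots> \<le> (LINT x:\<Omega>|lborel. divergence P x + e x)"
    proof (rule set_integral_mono)
      fix x assume x: "x \<in> \<Omega>"
      have "(1 - \<phi> x) * (- divergence P x) \<le> (1 - \<phi> x) * M"
        using M(3)[OF x] \<phi>(3)[of x] by (intro mult_left_mono) auto
      also have "\<dots> \<le> (\<Sum>m\<in>J. b m x) * M" by (intro mult_right_mono \<phi>(4) M(1))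
      finally have 1: "\<phi> x * divergence P x \<le> divergence P x + (\<Sum>m\<in>J. b m x) * M"
        by (simp add: algebra_simps)
      have "P x \<bullet> gradient \<phi> x \<le> norm (P x) * norm (gradient \<phi> x)" by (rule norm_cauchy_schwarz)
      also have "\<dots> \<le> M * (\<Sum>m\<in>J. norm (gradient (b m) x))"
        by (intro mult_mono M(1) M(2)[OF x] \<phi>(5)) auto
      finally have 2: "\<phi> x * divergence P x + P x \<bullet> gradient \<phi> x \<le>
          divergence P x + (\<Sum>m\<in>J. M * (b m x + norm (gradient (b m) x)))"
        using 1 by (simp add: sum.distrib sum_distrib_left algebra_simps)
      have "(\<Sum>m\<in>J. M * (b m x + norm (gradient (b m) x))) \<le> e x"
        unfolding e_def
      proof (rule sum_mono)
        fix m
        let ?i = "indicator (cball (c m) (2 * r m)) x :: real"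
        have "b m x \<le> 1 * ?i"
          using b(3) bump_eq_0[OF cr(1), of x "c m" m] unfolding b_def by (auto simp: indicator_def)
        also have "\<dots> \<le> 1 / r m * ?i"
          using r1[of m] cr(1)[of m] by (intro mult_right_mono) (auto simp: field_simps)
        finally have "b m x + norm (gradient (b m) x) \<le> 1 / r m * ?i + 8 / r m * ?i"
          using norm_gradient_bump[OF cr(1), of "c m" m x] unfolding b_def by linarith
        also have "\<dots> = 9 / r m * ?i" by (simp add: field_simps)
        finally show "M * (b m x + norm (gradient (b m) x)) \<le> M * (9 / r m) * ?i"
          using M(1) mult_left_mono by fastforce
      qed
      then show "\<phi> x * divergence P x + P x \<bullet> gradient \<phi> x \<le> divergence P x + e x" using 2 by linarith
    qed (use set_integrable_bcont[OF bcont_pairing[OF \<phi>(1)] \<Omega>] set_integral_add(1)[OF iD ie\<Omega>] in auto)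
    also have "\<dots> = (LINT x:\<Omega>|lborel. divergence P x) + (LINT x:\<Omega>|lborel. e x)"
      by (rule set_integral_add(2)[OF iD ie\<Omega>])
    finally show ?thesis
      using eb \<open>(LINT x:\<Omega>|lborel. e x) \<le> integral\<^sup>L lborel e\<close> by linarith
  qed
  have "((\<lambda>\<epsilon>. - (k * \<epsilon>)) \<longlongrightarrow> - (k * 0)) (at_right 0)" by (intro tendsto_intros)
  moreover have "\<forall>\<^sub>F \<epsilon> in at_right 0. - (k * \<epsilon>) \<le> (LINT x:\<Omega>|lborel. divergence P x)"
    using eventually_at_right_real[OF zero_less_one] by (rule eventually_mono) (auto intro: main)
  ultimately have "- (k * 0) \<le> (LINT x:\<Omega>|lborel. divergence P x)"
    by (rule tendsto_upperbound) simp
  then show ?thesis by simp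
qed

end

section \<open>Symmetry of second derivatives\<close>

text \<open>Two applications of the mean value theorem. The second difference is symmetric in \<open>a\<close> and \<open>b\<close>, whence the
  symmetry of second derivatives.\<close>

lemma second_difference_mean_value:
  fixes f :: "'a::real_normed_vector \<Rightarrow> real"
  assumes f: "\<And>y. y \<in> ball x R \<Longrightarrow> (f has_derivative f' y) (at y)"
    and fa: "\<And>y. y \<in> ball x R \<Longrightarrow> ((\<lambda>y. f' y a) has_derivative fa y) (at y)"
    and t: "0 < t" "t * (norm a + norm b) < R"
  obtains p where "dist p x \<le> t * (norm a + norm b)"
    "f (x + t *\<^sub>R a + t *\<^sub>R b) - f (x + t *\<^sub>R a) - f (x + t *\<^sub>R b) + f x = t * t * fa p b"
proof -
  have near: "dist (x + s *\<^sub>R a + r *\<^sub>R b) x \<le> t * (norm a + norm b)"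
    if "0 \<le> s" "s \<le> t" "0 \<le> r" "r \<le> t" for s r
  proof -
    have "norm (s *\<^sub>R a + r *\<^sub>R b) \<le> s * norm a + r * norm b"
      using norm_triangle_ineq[of "s *\<^sub>R a" "r *\<^sub>R b"] that by simp
    also have "\<dots> \<le> t * norm a + t * norm b"
      using that by (intro add_mono mult_right_mono) auto
    finally show ?thesis by (simp add: dist_norm algebra_simps)
  qed
  then have inball: "x + s *\<^sub>R a + r *\<^sub>R b \<in> ball x R"
    if "0 \<le> s" "s \<le> t" "0 \<le> r" "r \<le> t" for s r
    using near[OF that] t(2) by (simp add: dist_commute)
  have line: "((\<lambda>s. g (c + s *\<^sub>R v)) has_real_derivative g' v) (at s)"
    if "(g has_derivative g') (at (c + s *\<^sub>R v))" for g g' and c v :: 'a and s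
  proof -
    have "((\<lambda>s. g (c + s *\<^sub>R v)) has_derivative (\<lambda>s. g' (s *\<^sub>R v))) (at s)"
      by (rule has_derivative_compose[of "\<lambda>s. c + s *\<^sub>R v" _ _ _ g, OF _ that])
        (auto intro!: derivative_eq_intros)
    then show ?thesis unfolding has_field_derivative_def
      by (simp add: linear_cmul[OF has_derivative_linear[OF that]] mult_commute_abs)
  qed
  have d1: "((\<lambda>s. f (x + t *\<^sub>R b + s *\<^sub>R a) - f (x + s *\<^sub>R a)) has_real_derivative
      f' (x + t *\<^sub>R b + s *\<^sub>R a) a - f' (x + s *\<^sub>R a) a) (at s)" if "0 \<le> s" "s \<le> t" for s
    using f[OF inball[of s t]] f[OF inball[of s 0]] that t(1)
    by (intro DERIV_diff line) (auto simp: add_ac)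
  obtain s where s: "0 < s" "s < t" and s_eq:
    "(f (x + t *\<^sub>R b + t *\<^sub>R a) - f (x + t *\<^sub>R a)) - (f (x + t *\<^sub>R b + 0 *\<^sub>R a) - f (x + 0 *\<^sub>R a)) =
      (t - 0) * (f' (x + t *\<^sub>R b + s *\<^sub>R a) a - f' (x + s *\<^sub>R a) a)"
    using MVT2[OF t(1) d1] by blast
  have d2: "((\<lambda>r. f' (x + s *\<^sub>R a + r *\<^sub>R b) a) has_real_derivative fa (x + s *\<^sub>R a + r *\<^sub>R b) b) (at r)"
    if "0 \<le> r" "r \<le> t" for r
    using fa[OF inball[of s r]] that s by (intro line) auto
  obtain r where r: "0 < r" "r < t" and r_eq:
    "f' (x + s *\<^sub>R a + t *\<^sub>R b) a - f' (x + s *\<^sub>R a + 0 *\<^sub>R b) a = (t - 0) * fa (x + s *\<^sub>R a + r *\<^sub>R b) b"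
    using MVT2[OF t(1) d2] by blast
  show ?thesis
  proof (rule that[of "x + s *\<^sub>R a + r *\<^sub>R b"])
    show "dist (x + s *\<^sub>R a + r *\<^sub>R b) x \<le> t * (norm a + norm b)"
      using near[of s r] s r by simp
    show "f (x + t *\<^sub>R a + t *\<^sub>R b) - f (x + t *\<^sub>R a) - f (x + t *\<^sub>R b) + f x
        = t * t * fa (x + s *\<^sub>R a + r *\<^sub>R b) b"
      using s_eq r_eq by (simp add: add_ac mult.assoc)
  qed
qed

lemma symmetric_second_derivative:
  fixes f :: "'a::real_normed_vector \<Rightarrow> real"
  assumes W: "open W" "x \<in> W"
    and f: "\<And>y. y \<in> W \<Longrightarrow> (f has_derivative f' y) (at y)"
    and fa: "\<And>y. y \<in> W \<Longrightarrow> ((\<lambda>y. f' y a) has_derivative fa y) (at y)" "continuous_on W (\<lambda>y. fa y b)"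
    and fb: "\<And>y. y \<in> W \<Longrightarrow> ((\<lambda>y. f' y b) has_derivative fb y) (at y)" "continuous_on W (\<lambda>y. fb y a)"
  shows "fa x b = fb x a"
proof -
  have "\<bar>fa x b - fb x a\<bar> \<le> 0 + \<delta>" if \<delta>: "0 < \<delta>" for \<delta>
  proof -
    obtain R0 where R0: "0 < R0" "ball x R0 \<subseteq> W" using W open_contains_ball by blast
    have ev: "\<exists>e>0. \<forall>y\<in>W. dist y x < e \<longrightarrow> \<bar>q y - q x\<bar> < \<delta> / 2" if "continuous_on W q" for q :: "'a \<Rightarrow> real"
      using that W(2) \<delta> unfolding continuous_on_iff dist_real_def by (meson half_gt_zero)
    obtain e1 where e1: "0 < e1" "\<And>y. y \<in> W \<Longrightarrow> dist y x < e1 \<Longrightarrow> \<bar>fa y b - fa x b\<bar> < \<delta> / 2"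
      using ev[OF fa(2)] by blast
    obtain e2 where e2: "0 < e2" "\<And>y. y \<in> W \<Longrightarrow> dist y x < e2 \<Longrightarrow> \<bar>fb y a - fb x a\<bar> < \<delta> / 2"
      using ev[OF fb(2)] by blast
    define R where "R = min R0 (min e1 e2)"
    have R: "0 < R" "R \<le> R0" "R \<le> e1" "R \<le> e2" using R0 e1 e2 by (auto simp: R_def)
    define N where "N = norm a + norm b + 1"
    have N: "0 < N" by (simp add: N_def add_nonneg_pos)
    define t where "t = R / (2 * N)"
    have t: "0 < t" using R N by (simp add: t_def)
    have "t * (norm a + norm b) \<le> t * N" using t by (intro mult_left_mono) (auto simp: N_def)
    also have "\<dots> < R" using R N by (simp add: t_def)
    finally have tR: "t * (norm a + norm b) < R" "t * (norm b + norm a) < R" by (simp_all add: add_ac)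
    have sub: "y \<in> W" if "y \<in> ball x R" for y using that R R0 by auto
    obtain p where p: "dist p x \<le> t * (norm a + norm b)"
      "f (x + t *\<^sub>R a + t *\<^sub>R b) - f (x + t *\<^sub>R a) - f (x + t *\<^sub>R b) + f x = t * t * fa p b"
      using second_difference_mean_value[OF f[OF sub] fa(1)[OF sub] t tR(1)] by blast
    obtain q where q: "dist q x \<le> t * (norm b + norm a)"
      "f (x + t *\<^sub>R b + t *\<^sub>R a) - f (x + t *\<^sub>R b) - f (x + t *\<^sub>R a) + f x = t * t * fb q a"
      using second_difference_mean_value[OF f[OF sub] fb(1)[OF sub] t tR(2)] by blast
    have "f (x + t *\<^sub>R b + t *\<^sub>R a) = f (x + t *\<^sub>R a + t *\<^sub>R b)" by (simp add: add_ac)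
    then have "t * t * fa p b = t * t * fb q a" using p(2) q(2) by linarith
    then have "fa p b = fb q a" using t by simp
    moreover have "\<bar>fa p b - fa x b\<bar> < \<delta> / 2" using p(1) tR R sub[of p] by (intro e1(2)) (auto simp: dist_commute)
    moreover have "\<bar>fb q a - fb x a\<bar> < \<delta> / 2" using q(1) tR R sub[of q] by (intro e2(2)) (auto simp: dist_commute)
    ultimately show ?thesis by linarith
  qed
  then have "\<bar>fa x b - fb x a\<bar> \<le> 0" by (rule field_le_epsilon)
  then show ?thesis by simp
qed

lemma partial_deriv_commute:
  fixes u :: "real^'n \<Rightarrow> real^'m"
  assumes W: "open W" "x \<in> W" and u: "C2_on W u"
  shows "partial_deriv i (partial_deriv j u) x = partial_deriv j (partial_deriv i u) x"
proof -
  have C1: "C1_on W u" "\<And>i. C1_on W (partial_deriv i u)" using u by (auto simp: C2_on_def)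
  have "partial_deriv i (partial_deriv j u) x $ k = partial_deriv j (partial_deriv i u) x $ k" for k
  proof -
    let ?D = "\<lambda>(v :: real^'n \<Rightarrow> real^'m) y h. (\<Sum>i\<in>UNIV. h $ i *\<^sub>R partial_deriv i v y) $ k"
    have D: "((\<lambda>y. v y $ k) has_derivative ?D v y) (at y)" if "C1_on W v" "y \<in> W" for v y
      by (rule bounded_linear.has_derivative[OF bounded_linear_vec_nth C1_on_has_derivative[OF that]])
    have ax: "?D v y (axis i 1) = partial_deriv i v y $ k" if "C1_on W v" "y \<in> W" for v y i
      using partial_deriv_eq[OF C1_on_has_derivative[OF that], of i] by simp
    have D2: "((\<lambda>z. ?D u z (axis i 1)) has_derivative ?D (partial_deriv i u) y) (at y)" if "y \<in> W" for y i
      by (rule has_derivative_transform_within_open[OF D[OF C1(2) that] W(1) that])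
        (rule ax[OF C1(1), symmetric])
    have cont: "continuous_on W (\<lambda>y. ?D (partial_deriv i u) y (axis j 1))" for i j
    proof (rule continuous_on_eq[OF _ ax[OF C1(2), symmetric]])
      show "continuous_on W (\<lambda>y. partial_deriv j (partial_deriv i u) y $ k)"
        using C1(2) by (simp add: C1_on_def continuous_on_component)
    qed
    have "?D (partial_deriv j u) x (axis i 1) = ?D (partial_deriv i u) x (axis j 1)"
      by (rule symmetric_second_derivative[OF W D[OF C1(1)] D2 cont D2 cont])
    then show ?thesis by (simp only: ax[OF C1(2) W(2)])
  qed
  then show ?thesis by (simp add: vec_eq_iff)
qed

section \<open>Functions vanishing on the boundary\<close>

text \<open>The segment from \<open>y\<close> to the closest boundary point runs inside \<open>\<Omega>\<close>, and that point is at least as close as \<open>z\<close>,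
  because the segment from \<open>y\<close> to \<open>z\<close> meets the boundary.\<close>

lemma norm_le_dist_complement:
  fixes u :: "'a::euclidean_space \<Rightarrow> 'b::real_inner"
  assumes "open \<Omega>" and u: "\<And>y. y \<in> \<Omega> \<Longrightarrow> (u has_derivative u' y) (at y)"
    and M: "\<And>y h. y \<in> \<Omega> \<Longrightarrow> norm (u' y h) \<le> M * norm h" "0 \<le> M"
    and uc: "continuous_on (closure \<Omega>) u" and u0: "\<And>y. y \<in> frontier \<Omega> \<Longrightarrow> u y = 0"
    and y: "y \<in> \<Omega>" and z: "z \<notin> \<Omega>"
  shows "norm (u y) \<le> M * dist y z"
proof -
  have "closed_segment y z \<inter> frontier \<Omega> \<noteq> {}"
    by (rule connected_Int_frontier) (use y z in auto)
  then obtain p where p: "p \<in> frontier \<Omega>" "p \<in> closed_segment y z" by blast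
  obtain q where q: "q \<in> frontier \<Omega>" "\<And>p. p \<in> frontier \<Omega> \<Longrightarrow> dist y q \<le> dist y p"
    using distance_attains_inf[OF frontier_closed, of \<Omega> y] p(1) by blast
  have yq: "y \<noteq> q" using q(1) y assms(1) by (auto simp: frontier_def interior_open)
  have ball: "ball y (dist y q) \<subseteq> \<Omega>"
  proof (rule ccontr)
    assume "\<not> ?thesis"
    moreover have "y \<in> ball y (dist y q) \<inter> \<Omega>" using y yq by simp
    ultimately have "ball y (dist y q) \<inter> frontier \<Omega> \<noteq> {}"
      by (intro connected_Int_frontier) (simp, blast+)
    then show False using q(2) by force
  qed
  let ?s = "\<lambda>t. y + t *\<^sub>R (q - y)"
  have in\<Omega>: "?s t \<in> \<Omega>" if "t \<in> {0<..<1}" for t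
  proof -
    have "dist y (?s t) = t * dist y q" using that by (simp add: dist_norm norm_minus_commute)
    also have "\<dots> < dist y q" using that yq by simp
    finally show ?thesis using ball by auto
  qed
  have "\<exists>t\<in>{0<..<1}. norm (u (?s 1) - u (?s 0)) \<le> norm ((\<lambda>r. u' (?s t) (r *\<^sub>R (q - y))) (1 - 0))"
  proof (rule mvt_general)
    have "?s t \<in> closure \<Omega>" if t01: "t \<in> {0..1}" for t
    proof -
      consider "t = 0" | "t = 1" | "t \<in> {0<..<1}" using t01 by fastforce
      then show ?thesis
        using in\<Omega>[of t] y q(1) closure_subset[of \<Omega>] by cases (auto simp: frontier_def)
    qed
    then show "continuous_on {0..1} (\<lambda>t. u (?s t))"
      by (intro continuous_on_compose2[OF uc] continuous_intros) auto
    show "((\<lambda>t. u (?s t)) has_derivative (\<lambda>r. u' (?s t) (r *\<^sub>R (q - y)))) (at t)" if "0 < t" "t < 1" for t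
      by (rule has_derivative_compose[of "\<lambda>t. y + t *\<^sub>R (q - y)" _ _ _ u, OF _ u[OF in\<Omega>]])
        (use that in \<open>auto intro!: derivative_eq_intros\<close>)
  qed simp
  then obtain t where t: "t \<in> {0<..<1}" "norm (u q - u y) \<le> norm (u' (?s t) (q - y))" by auto
  have "norm (u y) \<le> M * dist y q"
    using t M(1)[OF in\<Omega>[OF t(1)], of "q - y"] u0[OF q(1)] by (simp add: dist_norm norm_minus_commute)
  also have "\<dots> \<le> M * dist y z"
    using q(2)[OF p(1)] dist_in_closed_segment[OF p(2)] M(2)
    by (intro mult_left_mono) (auto simp: dist_commute)
  finally show ?thesis .
qed

text \<open>A function that vanishes on the boundary has no tangential derivatives there. As \<open>\<Omega>\<close> need not contain
  tangent segments, a tangent vector \<open>\<tau>\<close> is first tilted inwards to \<open>\<tau> - \<kappa> \<nu>\<close>. At the points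
  \<open>x + t (\<tau> - \<kappa> \<nu>)\<close> the function is at most of size \<open>2 M \<kappa> t\<close>, since the nearby points
  \<open>x + t (\<tau> + \<kappa> \<nu>)\<close> lie outside; so the derivative in the tilted direction is of order \<open>\<kappa>\<close>.\<close>

lemma boundary_gradient_normal:
  fixes u :: "real^'n \<Rightarrow> 'b::real_inner"
  assumes \<Omega>: "open \<Omega>" "bounded \<Omega>" and u: "C1_on \<Omega> u" "continuous_on (closure \<Omega>) u"
    and u0: "\<And>y. y \<in> frontier \<Omega> \<Longrightarrow> u y = 0"
    and G: "\<And>i. continuous_on (closure \<Omega>) (G i)" "\<And>i y. y \<in> \<Omega> \<Longrightarrow> G i y = partial_deriv i u y"
    and x: "x \<in> frontier \<Omega>" "outward_unit_normal \<Omega> x \<nu>"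
  shows "G k x = \<nu> $ k *\<^sub>R (\<Sum>i\<in>UNIV. \<nu> $ i *\<^sub>R G i x)"
proof -
  define L where "L y h = (\<Sum>i\<in>UNIV. h $ i *\<^sub>R G i y)" for y and h :: "real^'n"
  have Llin: "linear (L y)" for y
    unfolding L_def by (intro linearI) (simp_all add: scaleR_left_distrib sum.distrib scaleR_sum_right)
  have Du: "(u has_derivative L y) (at y)" if "y \<in> \<Omega>" for y
    using C1_on_has_derivative[OF u(1) that] that unfolding L_def[abs_def] by (simp add: G(2))
  obtain B where B: "\<And>i y. y \<in> closure \<Omega> \<Longrightarrow> norm (G i y) \<le> B i"
  proof -
    have "compact (closure \<Omega>)" using \<Omega>(2) by simp
    then have "\<exists>B. \<forall>y\<in>closure \<Omega>. norm (G i y) \<le> B" for i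
      using compact_imp_bounded[OF compact_continuous_image[OF G(1)]] by (auto simp: bounded_iff)
    then show ?thesis using that by metis
  qed
  define M where "M = (\<Sum>i\<in>UNIV. \<bar>B i\<bar>)"
  have M0: "0 \<le> M" by (simp add: M_def sum_nonneg)
  have M: "norm (L y h) \<le> M * norm h" if "y \<in> \<Omega>" for y h
  proof -
    have "norm (L y h) \<le> (\<Sum>i\<in>UNIV. norm (h $ i *\<^sub>R G i y))" unfolding L_def by (rule norm_sum)
    also have "\<dots> \<le> (\<Sum>i\<in>UNIV. norm h * \<bar>B i\<bar>)"
    proof (rule sum_mono)
      fix i
      have "norm (G i y) \<le> \<bar>B i\<bar>" using B[of y i] that closure_subset[of \<Omega>] by force
      then show "norm (h $ i *\<^sub>R G i y) \<le> norm h * \<bar>B i\<bar>"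
        unfolding norm_scaleR using Finite_Cartesian_Product.norm_nth_le[of h i] by (intro mult_mono) auto
    qed
    finally show ?thesis by (simp add: M_def sum_distrib_left mult.commute)
  qed
  obtain U g where U: "open U" "x \<in> U" "C1_on U g" "g x = 0" "gradient g x \<noteq> 0"
    "\<Omega> \<inter> U = {y \<in> U. g y < 0}" "\<nu> = gradient g x /\<^sub>R norm (gradient g x)"
    using x(2) unfolding outward_unit_normal_def by blast
  have \<nu>1: "norm \<nu> = 1" using U(5,7) by simp
  have \<nu>\<nu>: "\<nu> \<bullet> \<nu> = 1" using \<nu>1 by (simp add: norm_eq_1)
  define w where "w = norm (gradient g x)"
  have w: "0 < w" "gradient g x = w *\<^sub>R \<nu>" using U(5,7) by (auto simp: w_def)
  have xcl: "x \<in> closure \<Omega>" using x(1) by (simp add: frontier_def)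
  have line: "((\<lambda>t. g (x + t *\<^sub>R v)) has_real_derivative w * (v \<bullet> \<nu>)) (at 0)" for v
  proof -
    have "((\<lambda>t. g (x + t *\<^sub>R v)) has_derivative (\<lambda>t. (t *\<^sub>R v) \<bullet> gradient g x)) (at 0)"
    proof (rule has_derivative_compose[of "\<lambda>t. x + t *\<^sub>R v"])
      show "(g has_derivative (\<lambda>h. h \<bullet> gradient g x)) (at (x + 0 *\<^sub>R v))"
        using C1_on_imp_GDERIV[OF U(3,2)] by (simp add: gderiv_def)
    qed (auto intro!: derivative_eq_intros)
    then show ?thesis unfolding has_field_derivative_def w(2) by (simp add: mult_commute_abs mult_ac)
  qed
  have inU: "\<forall>\<^sub>F t in at_right 0. x + t *\<^sub>R v \<in> U" for v
  proof -
    have "((\<lambda>t. x + t *\<^sub>R v) \<longlongrightarrow> x + 0 *\<^sub>R v) (at_right 0)" by (intro tendsto_intros)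
    then show ?thesis using topological_tendstoD[OF _ U(1)] U(2) by force
  qed
  have cone: "norm (L x (\<tau> - \<kappa> *\<^sub>R \<nu>)) \<le> 2 * M * \<kappa>" if \<tau>: "\<tau> \<bullet> \<nu> = 0" and \<kappa>: "0 < \<kappa>" for \<tau> \<kappa>
  proof (rule field_le_epsilon)
    fix \<delta> :: real assume \<delta>: "0 < \<delta>"
    define v where "v = \<tau> - \<kappa> *\<^sub>R \<nu>"
    define v' where "v' = \<tau> + \<kappa> *\<^sub>R \<nu>"
    have v: "w * (v \<bullet> \<nu>) < 0" "0 < w * (v' \<bullet> \<nu>)"
      using \<tau> \<kappa> w \<nu>\<nu> by (simp_all add: v_def v'_def inner_diff_left inner_add_left)
    obtain d1 where d1: "0 < d1" "\<And>t. 0 < t \<Longrightarrow> t < d1 \<Longrightarrow> g (x + t *\<^sub>R v) < 0"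
      using DERIV_neg_dec_right[OF line v(1)] U(4) by auto
    obtain d2 where d2: "0 < d2" "\<And>t. 0 < t \<Longrightarrow> t < d2 \<Longrightarrow> 0 < g (x + t *\<^sub>R v')"
      using DERIV_pos_inc_right[OF line v(2)] U(4) by auto
    obtain d3 where d3: "0 < d3" "\<And>t. 0 < t \<Longrightarrow> t < d3 \<Longrightarrow> x + t *\<^sub>R v \<in> U \<and> x + t *\<^sub>R v' \<in> U"
      using eventually_conj[OF inU[of v] inU[of v']] unfolding eventually_at_right_field by auto
    have "continuous_on (closure \<Omega>) (\<lambda>y. L y v)" unfolding L_def by (intro continuous_intros G(1))
    then obtain e where e: "0 < e" "\<And>y. y \<in> closure \<Omega> \<Longrightarrow> dist y x < e \<Longrightarrow> norm (L y v - L x v) < \<delta>"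
      using xcl \<delta> unfolding continuous_on_iff dist_norm by metis
    have nv: "0 < norm v + 1" by (simp add: add_nonneg_pos)
    define m where "m = min (min d1 (min d2 d3)) (e / (norm v + 1))"
    have m: "0 < m" "m \<le> d1" "m \<le> d2" "m \<le> d3" "m \<le> e / (norm v + 1)"
      using d1(1) d2(1) d3(1) e(1) nv by (auto simp: m_def)
    define t where "t = m / 2"
    have t: "0 < t" "t < d1" "t < d2" "t < d3" "t < e / (norm v + 1)"
      using m unfolding t_def by linarith+
    have seg: "x + s *\<^sub>R v \<in> \<Omega>" if "0 < s" "s \<le> t" for s
    proof -
      have "x + s *\<^sub>R v \<in> \<Omega> \<inter> U" unfolding U(6) using d1(2)[of s] d3(2)[of s] t that by simp
      then show ?thesis by blast
    qed
    have out: "x + t *\<^sub>R v' \<notin> \<Omega>"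
    proof -
      have "x + t *\<^sub>R v' \<notin> \<Omega> \<inter> U" unfolding U(6) using d2(2)[of t] t by simp
      then show ?thesis using d3(2)[of t] t by blast
    qed
    have "norm (u (x + t *\<^sub>R v)) \<le> M * dist (x + t *\<^sub>R v) (x + t *\<^sub>R v')"
      by (rule norm_le_dist_complement[OF \<Omega>(1) Du M M0 u(2) u0 seg out]) (use t in auto)
    also have "dist (x + t *\<^sub>R v) (x + t *\<^sub>R v') = 2 * \<kappa> * t"
    proof -
      have "x + t *\<^sub>R v - (x + t *\<^sub>R v') = (- (2 * \<kappa> * t)) *\<^sub>R \<nu>"
        by (simp add: v_def v'_def algebra_simps flip: scaleR_add_left)
      then show ?thesis using \<kappa> t \<nu>1 by (simp add: dist_norm)
    qed
    finally have 1: "norm (u (x + t *\<^sub>R v)) \<le> M * (2 * \<kappa> * t)" .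
    let ?f = "\<lambda>s. u (x + s *\<^sub>R v) - s *\<^sub>R L x v"
    have "\<exists>s\<in>{0<..<t}. norm (?f t - ?f 0) \<le> norm ((\<lambda>r. L (x + s *\<^sub>R v) (r *\<^sub>R v) - r *\<^sub>R L x v) (t - 0))"
    proof (rule mvt_general[OF t(1)])
      have "x + s *\<^sub>R v \<in> closure \<Omega>" if "s \<in> {0..t}" for s
        using seg[of s] that xcl closure_subset[of \<Omega>] by (cases "s = 0") auto
      then show "continuous_on {0..t} ?f"
        by (intro continuous_intros continuous_on_compose2[OF u(2)]) auto
      show "(?f has_derivative (\<lambda>r. L (x + s *\<^sub>R v) (r *\<^sub>R v) - r *\<^sub>R L x v)) (at s)" if "0 < s" "s < t" for s
      proof (rule has_derivative_diff)
        show "((\<lambda>s. u (x + s *\<^sub>R v)) has_derivative (\<lambda>r. L (x + s *\<^sub>R v) (r *\<^sub>R v))) (at s)"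
          by (rule has_derivative_compose[of "\<lambda>s. x + s *\<^sub>R v" _ _ _ u, OF _ Du[OF seg]])
            (use that in \<open>auto intro!: derivative_eq_intros\<close>)
      qed (auto intro!: derivative_eq_intros)
    qed
    then obtain s where s: "0 < s" "s < t"
      "norm (u (x + t *\<^sub>R v) - t *\<^sub>R L x v) \<le> norm (t *\<^sub>R (L (x + s *\<^sub>R v) v - L x v))"
      using u0[OF x(1)] linear_cmul[OF Llin] by (auto simp: scaleR_diff_right)
    have "dist (x + s *\<^sub>R v) x \<le> t * norm v" using s by (simp add: dist_norm mult_right_mono)
    also have "\<dots> < e"
    proof -
      have "t * norm v \<le> t * (norm v + 1)" using t by (intro mult_left_mono) auto
      also have "\<dots> < e" using t(5) nv by (simp add: pos_less_divide_eq)
      finally show ?thesis .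
    qed
    finally have "norm (L (x + s *\<^sub>R v) v - L x v) < \<delta>"
      using e(2) seg[of s] s closure_subset[of \<Omega>] by auto
    then have "norm (u (x + t *\<^sub>R v) - t *\<^sub>R L x v) \<le> t * \<delta>"
      using s(3) t(1) by (smt (verit) mult_left_mono norm_scaleR)
    then have "norm (t *\<^sub>R L x v) \<le> M * (2 * \<kappa> * t) + t * \<delta>"
      using 1 norm_triangle_ineq4[of "u (x + t *\<^sub>R v)" "u (x + t *\<^sub>R v) - t *\<^sub>R L x v"] by simp
    then have "t * norm (L x v) \<le> t * (2 * M * \<kappa> + \<delta>)" using t(1) by (simp add: algebra_simps)
    then show "norm (L x (\<tau> - \<kappa> *\<^sub>R \<nu>)) \<le> 2 * M * \<kappa> + \<delta>" using t(1) by (simp add: v_def)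
  qed
  have tangent: "L x \<tau> = 0" if \<tau>: "\<tau> \<bullet> \<nu> = 0" for \<tau>
  proof -
    have "norm (L x \<tau>) \<le> 0 + \<delta>" if \<delta>: "0 < \<delta>" for \<delta>
    proof -
      define N where "N = 2 * M + norm (L x \<nu>) + 1"
      have N: "0 < N" using M0 by (simp add: N_def add_nonneg_pos)
      define \<kappa> where "\<kappa> = \<delta> / N"
      have \<kappa>: "0 < \<kappa>" using \<delta> N by (simp add: \<kappa>_def)
      have "L x \<tau> = L x (\<tau> - \<kappa> *\<^sub>R \<nu>) + \<kappa> *\<^sub>R L x \<nu>"
        by (simp add: linear_diff[OF Llin] linear_cmul[OF Llin])
      then have "norm (L x \<tau>) \<le> norm (L x (\<tau> - \<kappa> *\<^sub>R \<nu>)) + \<kappa> * norm (L x \<nu>)"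
        using norm_triangle_ineq[of "L x (\<tau> - \<kappa> *\<^sub>R \<nu>)" "\<kappa> *\<^sub>R L x \<nu>"] \<kappa> by simp
      also have "\<dots> \<le> \<kappa> * N" using cone[OF \<tau> \<kappa>] \<kappa> by (simp add: N_def algebra_simps)
      finally show ?thesis using N by (simp add: \<kappa>_def)
    qed
    then have "norm (L x \<tau>) \<le> 0" by (rule field_le_epsilon)
    then show ?thesis by simp
  qed
  have "L x (axis k 1 - \<nu> $ k *\<^sub>R \<nu>) = 0"
    using \<nu>\<nu> by (intro tangent) (simp add: inner_diff_left inner_axis')
  then have "L x (axis k 1) = \<nu> $ k *\<^sub>R L x \<nu>"
    by (simp add: linear_diff[OF Llin] linear_cmul[OF Llin])
  moreover have "L x (axis k 1) = G k x"
    unfolding L_def by (simp add: axis_def if_distrib[of "\<lambda>z. z *\<^sub>R _"] cong: if_cong)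
  ultimately show ?thesis by (simp add: L_def)
qed

section \<open>Pohozaev's identity\<close>

text \<open>For \<open>a j k\<close> the derivative of \<open>u\<^sup>j\<close> in direction \<open>k\<close>, the elastic system
  says that the row-wise divergence of the stress is \<open>- f\<close>. The contraction \<open>\<Sum>i l. stress C a i l * a i l\<close> is called the
  energy of \<open>a\<close> below.\<close>

definition stress :: "('n \<Rightarrow> 'n \<Rightarrow> 'n \<Rightarrow> 'n \<Rightarrow> real) \<Rightarrow> ('n \<Rightarrow> 'n \<Rightarrow> real) \<Rightarrow> 'n::finite \<Rightarrow> 'n \<Rightarrow> real"
  where "stress C a i l = (\<Sum>j\<in>UNIV. \<Sum>k\<in>UNIV. C l k i j * a j k)"

lemma stress_symmetric:
  assumes "\<And>k l i j. C k l i j = C l k j i"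
  shows "(\<Sum>i\<in>UNIV. \<Sum>l\<in>UNIV. stress C a i l * b i l) = (\<Sum>i\<in>UNIV. \<Sum>l\<in>UNIV. stress C b i l * a i l)"
proof -
  have pairs: "(\<Sum>i\<in>UNIV. \<Sum>l\<in>UNIV. g i l) = (\<Sum>p\<in>UNIV. g (fst p) (snd p))" for g :: "'a \<Rightarrow> 'a \<Rightarrow> real"
    by (simp add: sum.cartesian_product case_prod_beta flip: UNIV_Times_UNIV)
  have expand: "(\<Sum>i\<in>UNIV. \<Sum>l\<in>UNIV. stress C a i l * b i l) = (\<Sum>p\<in>UNIV. \<Sum>q\<in>UNIV.
      C (snd p) (snd q) (fst p) (fst q) * a (fst q) (snd q) * b (fst p) (snd p))" for a b
    unfolding pairs[of "\<lambda>i l. stress C a i l * b i l"]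
    by (simp only: stress_def pairs sum_distrib_right)
  have "(\<Sum>i\<in>UNIV. \<Sum>l\<in>UNIV. stress C a i l * b i l) = (\<Sum>q\<in>UNIV. \<Sum>p\<in>UNIV.
      C (snd p) (snd q) (fst p) (fst q) * a (fst q) (snd q) * b (fst p) (snd p))"
    unfolding expand by (rule sum.swap)
  also have "\<dots> = (\<Sum>i\<in>UNIV. \<Sum>l\<in>UNIV. stress C b i l * a i l)"
    unfolding expand by (intro sum.cong refl) (subst assms, simp add: mult_ac)
  finally show ?thesis .
qed

text \<open>The field of Pohozaev's identity, from testing the system with \<open>(x \<bullet> \<nabla>) u + (n - 2) / 2 * u\<close>, the generator of
  dilations. Here \<open>y\<close> is the point, \<open>a\<close> the gradient, \<open>v\<close> the value of \<open>u\<close> and \<open>\<phi>\<close> that of \<open>F (u)\<close>. The gradient is an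
  argument because at boundary points it means the continuous extension of the gradient from inside.\<close>

definition pohozaev_flux ::
  "('n \<Rightarrow> 'n \<Rightarrow> 'n \<Rightarrow> 'n \<Rightarrow> real) \<Rightarrow> real^'n \<Rightarrow> ('n \<Rightarrow> 'n \<Rightarrow> real) \<Rightarrow> real^'n \<Rightarrow> real \<Rightarrow> real^'n"
  where "pohozaev_flux C y a v \<phi> = (\<chi> l.
    (\<Sum>i\<in>UNIV. ((\<Sum>m\<in>UNIV. y $ m * a i m) + (real CARD('n) - 2) / 2 * v $ i) * stress C a i l)
    - y $ l * ((\<Sum>i\<in>UNIV. \<Sum>k\<in>UNIV. stress C a i k * a i k) / 2 - \<phi>))"

text \<open>All terms that contain second derivatives cancel, by the equation and by the symmetry of \<open>h\<close>, where
  \<open>h i m l\<close> stands for the second derivative of \<open>u\<^sup>i\<close>. The energy occurs with the factor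
  \<open>1 + (n - 2) / 2 - n / 2 = 0\<close>, which is what singles out the coefficient \<open>(n - 2) / 2\<close>.\<close>

lemma pohozaev_divergence_algebra:
  fixes y v f :: "real^'n" and a :: "'n \<Rightarrow> 'n \<Rightarrow> real" and h :: "'n \<Rightarrow> 'n \<Rightarrow> 'n \<Rightarrow> real"
  assumes h: "\<And>i m l. h i m l = h i l m"
    and eq: "\<And>i. (\<Sum>l\<in>UNIV. stress C (\<lambda>j k. h j k l) i l) = - f $ i"
  shows "(\<Sum>l\<in>UNIV. (\<Sum>i\<in>UNIV.
        ((\<Sum>m\<in>UNIV. y $ m * a i m) + (real CARD('n) - 2) / 2 * v $ i) * stress C (\<lambda>j k. h j k l) i l
      + (a i l + (\<Sum>m\<in>UNIV. y $ m * h i m l) + (real CARD('n) - 2) / 2 * a i l) * stress C a i l)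
      - (y $ l * ((\<Sum>i\<in>UNIV. \<Sum>k\<in>UNIV. stress C a i k * h i k l) - (\<Sum>i\<in>UNIV. f $ i * a i l))
        + ((\<Sum>i\<in>UNIV. \<Sum>k\<in>UNIV. stress C a i k * a i k) / 2 - \<phi>)))
    = real CARD('n) * \<phi> - (real CARD('n) - 2) / 2 * (\<Sum>i\<in>UNIV. v $ i * f $ i)"
proof -
  define \<kappa> where "\<kappa> = (real CARD('n) - 2) / 2"
  define Q where "Q = (\<Sum>i\<in>UNIV. \<Sum>k\<in>UNIV. stress C a i k * a i k)"
  define b where "b i = (\<Sum>m\<in>UNIV. y $ m * a i m)" for i
  define S where "S l = (\<Sum>i\<in>UNIV. \<Sum>k\<in>UNIV. stress C a i k * h i k l)" for l
  have t1: "(\<Sum>l\<in>UNIV. \<Sum>i\<in>UNIV. (b i + \<kappa> * v $ i) * stress C (\<lambda>j k. h j k l) i l)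
      = - (\<Sum>i\<in>UNIV. b i * f $ i) - \<kappa> * (\<Sum>i\<in>UNIV. v $ i * f $ i)"
    by (subst sum.swap) (simp add: eq sum_subtractf sum_distrib_left distrib_right mult_ac
        sum_negf sum.distrib flip: sum_distrib_left)
  have t2: "(\<Sum>l\<in>UNIV. \<Sum>i\<in>UNIV. (1 + \<kappa>) * a i l * stress C a i l) = (1 + \<kappa>) * Q"
    unfolding Q_def by (subst sum.swap) (simp add: sum_distrib_left mult_ac)
  have t3: "(\<Sum>l\<in>UNIV. \<Sum>i\<in>UNIV. (\<Sum>m\<in>UNIV. y $ m * h i m l) * stress C a i l) = (\<Sum>l\<in>UNIV. y $ l * S l)"
  proof -
    have "(\<Sum>l\<in>UNIV. \<Sum>i\<in>UNIV. (\<Sum>m\<in>UNIV. y $ m * h i m l) * stress C a i l)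
        = (\<Sum>l\<in>UNIV. \<Sum>i\<in>UNIV. \<Sum>m\<in>UNIV. y $ m * (stress C a i l * h i l m))"
      unfolding sum_distrib_right by (intro sum.cong refl, subst h) (simp add: mult_ac)
    also have "\<dots> = (\<Sum>i\<in>UNIV. \<Sum>l\<in>UNIV. \<Sum>m\<in>UNIV. y $ m * (stress C a i l * h i l m))"
      by (rule sum.swap)
    also have "\<dots> = (\<Sum>i\<in>UNIV. \<Sum>m\<in>UNIV. \<Sum>l\<in>UNIV. y $ m * (stress C a i l * h i l m))"
      by (intro sum.cong refl sum.swap)
    also have "\<dots> = (\<Sum>m\<in>UNIV. \<Sum>i\<in>UNIV. \<Sum>l\<in>UNIV. y $ m * (stress C a i l * h i l m))"
      by (rule sum.swap)
    finally show ?thesis by (simp add: S_def sum_distrib_left)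
  qed
  have t4: "(\<Sum>l\<in>UNIV. y $ l * (\<Sum>i\<in>UNIV. f $ i * a i l)) = (\<Sum>i\<in>UNIV. b i * f $ i)"
    unfolding b_def sum_distrib_left sum_distrib_right by (subst sum.swap) (simp add: mult_ac)
  have "(\<Sum>l\<in>UNIV. (\<Sum>i\<in>UNIV. (b i + \<kappa> * v $ i) * stress C (\<lambda>j k. h j k l) i l
      + (a i l + (\<Sum>m\<in>UNIV. y $ m * h i m l) + \<kappa> * a i l) * stress C a i l)
      - (y $ l * (S l - (\<Sum>i\<in>UNIV. f $ i * a i l)) + (Q / 2 - \<phi>)))
    = (\<Sum>l\<in>UNIV. \<Sum>i\<in>UNIV. (b i + \<kappa> * v $ i) * stress C (\<lambda>j k. h j k l) i l)
      + (\<Sum>l\<in>UNIV. \<Sum>i\<in>UNIV. (1 + \<kappa>) * a i l * stress C a i l)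
      + (\<Sum>l\<in>UNIV. \<Sum>i\<in>UNIV. (\<Sum>m\<in>UNIV. y $ m * h i m l) * stress C a i l)
      - (\<Sum>l\<in>UNIV. y $ l * S l) + (\<Sum>l\<in>UNIV. y $ l * (\<Sum>i\<in>UNIV. f $ i * a i l))
      - real CARD('n) * (Q / 2 - \<phi>)"
    unfolding sum.distrib[symmetric] sum_subtractf[symmetric]
    by (simp add: sum_subtractf sum.distrib distrib_right right_diff_distrib)
  also have "\<dots> = real CARD('n) * \<phi> - \<kappa> * (\<Sum>i\<in>UNIV. v $ i * f $ i)"
    unfolding t1 t2 t3 t4 by (simp add: \<kappa>_def field_simps)
  finally show ?thesis by (simp only: \<kappa>_def Q_def b_def S_def)
qed

lemma has_derivative_vec_lambda:
  fixes f :: "'a::real_normed_vector \<Rightarrow> 'n::finite \<Rightarrow> real"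
  assumes "\<And>l. ((\<lambda>x. f x l) has_derivative (\<lambda>h. f' h l)) (at x)"
  shows "((\<lambda>x. \<chi> l. f x l) has_derivative (\<lambda>h. \<chi> l. f' h l)) (at x)"
  using assms by (subst has_derivative_componentwise_within) (auto simp: Basis_vec_def inner_axis)

lemma divergence_pohozaev_flux:
  fixes u :: "real^'n \<Rightarrow> real^'n" and F :: "real^'n \<Rightarrow> real"
  assumes \<Omega>: "open \<Omega>" and u: "C2_on \<Omega> u" and F: "C1_on UNIV F"
    and C: "\<And>k l i j. C k l i j = C l k j i"
    and sys: "anisotropic_system C (gradient F) \<Omega> u"
  defines "P \<equiv> \<lambda>y. pohozaev_flux C y (\<lambda>i k. partial_deriv k u y $ i) (u y) (F (u y))"
  shows "C1_on \<Omega> P"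
    and "\<And>y. y \<in> \<Omega> \<Longrightarrow> divergence P y =
      real CARD('n) * F (u y) - (real CARD('n) - 2) / 2 * (\<Sum>i\<in>UNIV. u y $ i * gradient F (u y) $ i)"
proof -
  define \<kappa> where "\<kappa> = (real CARD('n) - 2) / 2"
  define a where "a y i k = partial_deriv k u y $ i" for y i k
  define A where "A y h i k = (\<Sum>l\<in>UNIV. h $ l *\<^sub>R partial_deriv l (partial_deriv k u) y) $ i" for y h i k
  define v' where "v' y h = (\<Sum>l\<in>UNIV. h $ l *\<^sub>R partial_deriv l u y)" for y h
  have C1: "C1_on \<Omega> u" "C1_on \<Omega> (partial_deriv k u)" for k using u by (auto simp: C2_on_def)
  have dv: "(u has_derivative v' y) (at y)" if "y \<in> \<Omega>" for y
    using C1_on_has_derivative[OF C1(1) that] by (simp add: v'_def[abs_def])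
  have dv_i: "((\<lambda>y. u y $ i) has_derivative (\<lambda>h. v' y h $ i)) (at y)" if "y \<in> \<Omega>" for y i
    by (rule bounded_linear.has_derivative[OF bounded_linear_vec_nth dv[OF that]])
  have da: "((\<lambda>y. a y i k) has_derivative (\<lambda>h. A y h i k)) (at y)" if "y \<in> \<Omega>" for y i k
    unfolding a_def A_def
    by (rule bounded_linear.has_derivative[OF bounded_linear_vec_nth C1_on_has_derivative[OF C1(2) that]])
  have dF: "((\<lambda>y. F (u y)) has_derivative (\<lambda>h. \<Sum>i\<in>UNIV. gradient F (u y) $ i * v' y h $ i)) (at y)"
    if "y \<in> \<Omega>" for y
    using has_derivative_compose[OF dv[OF that] C1_on_imp_GDERIV[OF F UNIV_I, unfolded gderiv_def]]
    by (simp add: inner_vec_def mult.commute)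
  have ds: "((\<lambda>y. stress C (a y) i l) has_derivative (\<lambda>h. stress C (A y h) i l)) (at y)"
    if "y \<in> \<Omega>" for y i l
    unfolding stress_def by (intro has_derivative_sum has_derivative_mult_right da that)
  have dQ: "((\<lambda>y. (\<Sum>i\<in>UNIV. \<Sum>k\<in>UNIV. stress C (a y) i k * a y i k) / 2) has_derivative
      (\<lambda>h. \<Sum>i\<in>UNIV. \<Sum>k\<in>UNIV. stress C (a y) i k * A y h i k)) (at y)" if "y \<in> \<Omega>" for y
  proof -
    have "((\<lambda>y. (\<Sum>i\<in>UNIV. \<Sum>k\<in>UNIV. stress C (a y) i k * a y i k) / 2) has_derivative
      (\<lambda>h. (\<Sum>i\<in>UNIV. \<Sum>k\<in>UNIV. stress C (a y) i k * A y h i k + stress C (A y h) i k * a y i k) / 2)) (at y)"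
      by (rule bounded_linear.has_derivative[OF bounded_linear_divide])
        (intro has_derivative_sum has_derivative_mult da ds that)
    moreover have "(\<Sum>i\<in>UNIV. \<Sum>k\<in>UNIV. stress C (a y) i k * A y h i k + stress C (A y h) i k * a y i k) / 2
        = (\<Sum>i\<in>UNIV. \<Sum>k\<in>UNIV. stress C (a y) i k * A y h i k)" for h
      unfolding sum.distrib stress_symmetric[OF C, where a = "A y h"] by simp
    ultimately show ?thesis by simp
  qed
  define P' where "P' y h = (\<chi> l.
    (\<Sum>i\<in>UNIV. ((\<Sum>m\<in>UNIV. y $ m * a y i m) + \<kappa> * u y $ i) * stress C (A y h) i l
      + ((\<Sum>m\<in>UNIV. y $ m * A y h i m + h $ m * a y i m) + \<kappa> * v' y h $ i) * stress C (a y) i l)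
    - (y $ l * ((\<Sum>i\<in>UNIV. \<Sum>k\<in>UNIV. stress C (a y) i k * A y h i k)
          - (\<Sum>i\<in>UNIV. gradient F (u y) $ i * v' y h $ i))
      + h $ l * ((\<Sum>i\<in>UNIV. \<Sum>k\<in>UNIV. stress C (a y) i k * a y i k) / 2 - F (u y))))" for y h
  have P_eq: "P = (\<lambda>y. \<chi> l.
      (\<Sum>i\<in>UNIV. ((\<Sum>m\<in>UNIV. y $ m * a y i m) + \<kappa> * u y $ i) * stress C (a y) i l)
      - y $ l * ((\<Sum>i\<in>UNIV. \<Sum>k\<in>UNIV. stress C (a y) i k * a y i k) / 2 - F (u y)))"
    unfolding P_def pohozaev_flux_def \<kappa>_def a_def by simp
  have DP: "(P has_derivative P' y) (at y)" if "y \<in> \<Omega>" for y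
    unfolding P_eq P'_def
    by (intro has_derivative_vec_lambda has_derivative_diff has_derivative_sum has_derivative_mult
        has_derivative_add has_derivative_mult_right dv_i da ds dQ dF that
        bounded_linear.has_derivative[OF bounded_linear_vec_nth] has_derivative_ident)
  have v'_ax: "v' y (axis l 1) $ i = a y i l" if "y \<in> \<Omega>" for y i l
    using partial_deriv_eq[OF dv[OF that], of l] by (simp add: a_def)
  have A_ax: "A y (axis l 1) i k = partial_deriv l (partial_deriv k u) y $ i" if "y \<in> \<Omega>" for y i k l
    unfolding A_def using partial_deriv_eq[OF C1_on_has_derivative[OF C1(2) that], of l] by simp
  show "C1_on \<Omega> P"
  proof (rule C1_onI[OF DP])
    fix l
    have ca: "continuous_on \<Omega> (\<lambda>y. a y i k)" "continuous_on \<Omega> (\<lambda>y. A y (axis l 1) i k)" for i k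
    proof -
      show "continuous_on \<Omega> (\<lambda>y. a y i k)"
        unfolding a_def by (intro continuous_on_component C1_on_imp_continuous_on C1)
      have "continuous_on \<Omega> (\<lambda>y. partial_deriv l (partial_deriv k u) y $ i)"
        using C1(2) by (simp add: C1_on_def continuous_on_component)
      then show "continuous_on \<Omega> (\<lambda>y. A y (axis l 1) i k)"
        by (rule continuous_on_eq) (simp add: A_ax)
    qed
    have cv: "continuous_on \<Omega> (\<lambda>y. v' y (axis l 1) $ i)" for i
      using ca(1)[of i l] by (rule continuous_on_eq) (simp add: v'_ax)
    have cu: "continuous_on \<Omega> u" by (rule C1_on_imp_continuous_on[OF C1(1)])
    have cF: "continuous_on \<Omega> (\<lambda>y. F (u y))" "continuous_on \<Omega> (\<lambda>y. gradient F (u y))"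
      using continuous_on_compose2[OF C1_on_imp_continuous_on[OF F] cu]
        continuous_on_compose2[OF C1_on_gradient_continuous[OF F] cu] by auto
    show "continuous_on \<Omega> (\<lambda>y. P' y (axis l 1))"
      unfolding P'_def stress_def
      by (intro continuous_on_vec_lambda continuous_on_diff continuous_on_add continuous_on_sum
          continuous_on_mult continuous_on_divide continuous_on_const continuous_on_component
          continuous_on_id ca cv cu cF) auto
  qed
  fix y assume y: "y \<in> \<Omega>"
  define h where "h i m l = partial_deriv l (partial_deriv m u) y $ i" for i m l
  have h_sym: "h i m l = h i l m" for i m l
    unfolding h_def by (simp add: partial_deriv_commute[OF \<Omega> y u, of l m])
  have eq: "(\<Sum>l\<in>UNIV. stress C (\<lambda>j k. h j k l) i l) = - gradient F (u y) $ i" for i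
  proof -
    have "(\<Sum>l\<in>UNIV. stress C (\<lambda>j k. h j k l) i l)
        = (\<Sum>j\<in>UNIV. \<Sum>l\<in>UNIV. \<Sum>k\<in>UNIV. C l k i j * h j k l)"
      unfolding stress_def by (rule sum.swap)
    also have "\<dots> = (\<Sum>j\<in>UNIV. \<Sum>k\<in>UNIV. \<Sum>l\<in>UNIV. C k l i j * h j k l)"
      by (simp only: h_sym)
    also have "\<dots> = - gradient F (u y) $ i"
      using sys y unfolding anisotropic_system_def h_def by (simp add: add_eq_0_iff2)
    finally show ?thesis .
  qed
  have ax: "(\<Sum>m\<in>UNIV. axis l 1 $ m * z m) = z l" for l :: 'n and z :: "'n \<Rightarrow> real"
    by (simp add: axis_def if_distrib[of "\<lambda>z. z * _"] cong: if_cong)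
  have A_h: "A y (axis l 1) = (\<lambda>i k. h i k l)" for l
    by (simp add: fun_eq_iff A_ax[OF y] h_def)
  have "divergence P y = (\<Sum>l\<in>UNIV. P' y (axis l 1) $ l)"
    unfolding divergence_def partial_deriv_eq[OF DP[OF y]] ..
  also have "\<dots> = (\<Sum>l\<in>UNIV. (\<Sum>i\<in>UNIV.
        ((\<Sum>m\<in>UNIV. y $ m * a y i m) + \<kappa> * u y $ i) * stress C (\<lambda>j k. h j k l) i l
      + (a y i l + (\<Sum>m\<in>UNIV. y $ m * h i m l) + \<kappa> * a y i l) * stress C (a y) i l)
      - (y $ l * ((\<Sum>i\<in>UNIV. \<Sum>k\<in>UNIV. stress C (a y) i k * h i k l)
            - (\<Sum>i\<in>UNIV. gradient F (u y) $ i * a y i l))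
        + ((\<Sum>i\<in>UNIV. \<Sum>k\<in>UNIV. stress C (a y) i k * a y i k) / 2 - F (u y))))"
    unfolding P'_def A_h by (simp add: v'_ax[OF y] sum.distrib[of "\<lambda>m. y $ m * h _ m _"] ax axis_nth add_ac)
  also have "\<dots> = real CARD('n) * F (u y) - \<kappa> * (\<Sum>i\<in>UNIV. u y $ i * gradient F (u y) $ i)"
    unfolding \<kappa>_def by (rule pohozaev_divergence_algebra[OF h_sym eq])
  finally show "divergence P y =
      real CARD('n) * F (u y) - (real CARD('n) - 2) / 2 * (\<Sum>i\<in>UNIV. u y $ i * gradient F (u y) $ i)"
    by (simp only: \<kappa>_def)
qed

text \<open>On the boundary \<open>u = 0\<close> and the gradient is the rank-one matrix \<open>b \<nu>\<close>. Then \<open>(x \<bullet> \<nabla>) u\<close> is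
  \<open>(x \<bullet> \<nu>) b\<close>, and the flux is \<open>x \<bullet> \<nu>\<close> times half the energy of \<open>b \<nu>\<close>.\<close>

lemma pohozaev_flux_boundary:
  fixes x \<nu> b :: "real^'n"
  assumes pos: "0 \<le> (\<Sum>i\<in>UNIV. \<Sum>k\<in>UNIV. stress C (\<lambda>i k. b $ i * \<nu> $ k) i k * (b $ i * \<nu> $ k))"
    and x: "0 \<le> x \<bullet> \<nu>"
  shows "0 \<le> pohozaev_flux C x (\<lambda>i k. b $ i * \<nu> $ k) 0 0 \<bullet> \<nu>"
proof -
  define s where "s = stress C (\<lambda>i k. b $ i * \<nu> $ k)"
  define Q where "Q = (\<Sum>i\<in>UNIV. \<Sum>k\<in>UNIV. s i k * (b $ i * \<nu> $ k))"
  have q: "(\<Sum>l\<in>UNIV. \<Sum>i\<in>UNIV. b $ i * s i l * \<nu> $ l) = Q"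
    unfolding Q_def by (subst sum.swap) (simp add: mult_ac)
  define c where "c = x \<bullet> \<nu>"
  have "(\<Sum>m\<in>UNIV. x $ m * (b $ i * \<nu> $ m)) = c * b $ i" for i
    by (simp add: c_def inner_vec_def sum_distrib_left mult_ac)
  then have "pohozaev_flux C x (\<lambda>i k. b $ i * \<nu> $ k) 0 0 \<bullet> \<nu>
      = (\<Sum>l\<in>UNIV. ((\<Sum>i\<in>UNIV. c * b $ i * s i l) - x $ l * (Q / 2)) * \<nu> $ l)"
    by (simp add: inner_vec_def pohozaev_flux_def s_def Q_def)
  also have "\<dots> = c * (\<Sum>l\<in>UNIV. \<Sum>i\<in>UNIV. b $ i * s i l * \<nu> $ l) - c * (Q / 2)"
  proof -
    have "(\<Sum>l\<in>UNIV. (\<Sum>i\<in>UNIV. c * b $ i * s i l) * \<nu> $ l) = c * (\<Sum>l\<in>UNIV. \<Sum>i\<in>UNIV. b $ i * s i l * \<nu> $ l)"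
      by (simp add: sum_distrib_left sum_distrib_right mult_ac)
    moreover have "(\<Sum>l\<in>UNIV. x $ l * (Q / 2) * \<nu> $ l) = c * (Q / 2)"
      unfolding c_def inner_vec_def sum_distrib_right by (simp add: mult_ac)
    ultimately show ?thesis by (simp only: left_diff_distrib sum_subtractf)
  qed
  also have "\<dots> = c * Q / 2" unfolding q by simp
  finally have "pohozaev_flux C x (\<lambda>i k. b $ i * \<nu> $ k) 0 0 \<bullet> \<nu> = c * Q / 2" .
  moreover have "0 \<le> c" "0 \<le> Q" using pos x by (simp_all add: Q_def s_def c_def)
  ultimately show ?thesis by (simp only: divide_nonneg_nonneg mult_nonneg_nonneg zero_le_numeral)
qed

section \<open>Non-existence of solutions\<close>

lemma C1_on_cong:
  fixes P Q :: "real^'n \<Rightarrow> real^'n"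
  assumes "open U" "\<And>y. y \<in> U \<Longrightarrow> Q y = P y" "C1_on U Q"
  shows "C1_on U P" "\<And>y. y \<in> U \<Longrightarrow> divergence P y = divergence Q y"
proof -
  have D: "(P has_derivative (\<lambda>h. \<Sum>i\<in>UNIV. h $ i *\<^sub>R partial_deriv i Q y)) (at y)" if "y \<in> U" for y
    by (rule has_derivative_transform_within_open[OF C1_on_has_derivative[OF assms(3) that] assms(1) that assms(2)])
  have ax: "(\<Sum>j\<in>UNIV. axis i 1 $ j *\<^sub>R partial_deriv j Q y) = partial_deriv i Q y" if "y \<in> U" for y i
    using partial_deriv_eq[OF C1_on_has_derivative[OF assms(3) that], of i] by simp
  show "C1_on U P"
  proof (rule C1_onI[OF D])
    fix i
    have "continuous_on U (partial_deriv i Q)" using assms(3) by (simp add: C1_on_def)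
    then show "continuous_on U (\<lambda>y. \<Sum>j\<in>UNIV. axis i 1 $ j *\<^sub>R partial_deriv j Q y)"
      by (rule continuous_on_eq) (simp only: ax)
  qed
  show "divergence P y = divergence Q y" if "y \<in> U" for y
    unfolding divergence_def partial_deriv_eq[OF D[OF that]] ax[OF that] ..
qed

lemma integral_nonpos_imp_zero:
  fixes D :: "real^'n \<Rightarrow> real"
  assumes \<Omega>: "open \<Omega>" and D: "set_integrable lborel \<Omega> D" "continuous_on \<Omega> D" "\<And>y. y \<in> \<Omega> \<Longrightarrow> D y \<le> 0"
    and int: "0 \<le> (LINT y:\<Omega>|lborel. D y)" and x: "x \<in> \<Omega>"
  shows "D x = 0"
proof (rule ccontr)
  assume "D x \<noteq> 0"
  then have neg: "D x < 0" using D(3)[OF x] by simp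
  have "open {y \<in> \<Omega>. D y < D x / 2}"
    using continuous_open_preimage[OF D(2) \<Omega>, of "{..<D x / 2}"] by (simp add: vimage_def Int_def)
  moreover have "x \<in> {y \<in> \<Omega>. D y < D x / 2}" using neg x by simp
  ultimately obtain e where e: "0 < e" "ball x e \<subseteq> {y \<in> \<Omega>. D y < D x / 2}"
    by (meson open_contains_ball)
  have i: "integrable lborel (\<lambda>y. D x / 2 * indicator (ball x e) y)"
    using emeasure_bounded_finite[OF bounded_ball, of x e]
    by (intro integrable_mult_right integrable_real_indicator) auto
  have eq: "indicator \<Omega> y *\<^sub>R (D x / 2 * indicator (ball x e) y) = D x / 2 * indicator (ball x e) y" for y
    using e(2) by (auto simp: indicator_def)
  have "(LINT y:\<Omega>|lborel. D y) \<le> (LINT y:\<Omega>|lborel. D x / 2 * indicator (ball x e) y)"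
  proof (rule set_integral_mono[OF D(1)])
    show "set_integrable lborel \<Omega> (\<lambda>y. D x / 2 * indicator (ball x e) y)"
      unfolding set_integrable_def eq by (rule i)
    show "D y \<le> D x / 2 * indicator (ball x e) y" if "y \<in> \<Omega>" for y
      using e(2) D(3)[OF that] by (cases "y \<in> ball x e") auto
  qed
  also have "\<dots> = D x / 2 * measure lborel (ball x e)"
    unfolding set_lebesgue_integral_def eq by simp
  also have "\<dots> < 0" using neg content_ball_gt_0_iff[of x e] e(1) by (simp add: mult_neg_pos)
  finally show False using int by simp
qed

text \<open>The symmetry under exchange of the two index pairs is the one that makes the energy form symmetric; both kinds
  of moduli in the final theorem have it, so that both systems are instances of this lemma.\<close>

lemma pohozaev_nonexistence:
  fixes \<Omega> :: "(real^'n) set" and F :: "real^'n \<Rightarrow> real" and u :: "real^'n \<Rightarrow> real^'n"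
  assumes dim: "CARD('n) \<ge> 2"
    and dom: "open \<Omega>" "bounded \<Omega>" "piecewise_smooth_boundary \<Omega>" "star_shaped_wrt_origin \<Omega>"
    and F: "C1_on UNIV F" "F 0 = 0"
    and F_nonneg: "\<And>s. (real CARD('n) - 2) / 2 * (\<Sum>k\<in>UNIV. s $ k * partial_deriv k F s)
                         - real CARD('n) * F s \<ge> 0"
    and F_eq: "\<And>s. (real CARD('n) - 2) / 2 * (\<Sum>k\<in>UNIV. s $ k * partial_deriv k F s)
                         - real CARD('n) * F s = 0 \<Longrightarrow> s = 0"
    and C: "\<And>k l i j. C k l i j = C l k j i"
      "\<And>a. 0 \<le> (\<Sum>i\<in>UNIV. \<Sum>k\<in>UNIV. stress C a i k * a i k)"
    and u: "C2_on \<Omega> u" "C1_on_closure \<Omega> u" "\<And>x. x \<in> frontier \<Omega> \<Longrightarrow> u x = 0"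
    and sys: "anisotropic_system C (gradient F) \<Omega> u"
    and x: "x \<in> \<Omega>"
  shows "u x = 0"
proof -
  have cl: "compact (closure \<Omega>)" using dom(2) by simp
  have uc: "continuous_on (closure \<Omega>) u" and u1: "C1_on \<Omega> u"
    using u(2) by (auto simp: C1_on_closure_def)
  obtain G where G: "\<And>i. continuous_on (closure \<Omega>) (G i)" "\<And>i y. y \<in> \<Omega> \<Longrightarrow> G i y = partial_deriv i u y"
    using u(2) unfolding C1_on_closure_def by metis
  have Fc: "continuous_on (closure \<Omega>) (\<lambda>y. F (u y))" "continuous_on (closure \<Omega>) (\<lambda>y. gradient F (u y))"
    using continuous_on_compose2[OF C1_on_imp_continuous_on[OF F(1)] uc]
      continuous_on_compose2[OF C1_on_gradient_continuous[OF F(1)] uc] by auto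
  define P where "P y = pohozaev_flux C y (\<lambda>i k. G k y $ i) (u y) (F (u y))" for y
  define D where "D y = real CARD('n) * F (u y)
    - (real CARD('n) - 2) / 2 * (\<Sum>i\<in>UNIV. u y $ i * gradient F (u y) $ i)" for y
  note P0 = divergence_pohozaev_flux[OF dom(1) u(1) F(1) C(1) sys]
  have eq: "pohozaev_flux C y (\<lambda>i k. partial_deriv k u y $ i) (u y) (F (u y)) = P y" if "y \<in> \<Omega>" for y
    using that by (simp add: P_def G(2))
  have P1: "C1_on \<Omega> P" by (rule C1_on_cong(1)[OF dom(1) _ P0(1)]) (rule eq)
  have div_P: "divergence P y = D y" if "y \<in> \<Omega>" for y
    unfolding D_def P0(2)[OF that, symmetric] by (rule C1_on_cong(2)[OF dom(1) _ P0(1) that]) (rule eq)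
  have Pc: "continuous_on (closure \<Omega>) P"
    unfolding P_def[abs_def] pohozaev_flux_def stress_def
    by (intro continuous_on_vec_lambda continuous_on_diff continuous_on_add continuous_on_sum
        continuous_on_mult continuous_on_divide continuous_on_const continuous_on_component
        continuous_on_id G(1) uc Fc) auto
  have Dc: "continuous_on (closure \<Omega>) D"
    unfolding D_def[abs_def] by (intro continuous_intros uc Fc)
  have bD: "bcont \<Omega> D" by (rule bcont_compact[OF Dc cl closure_subset])
  have "bounded (divergence P ` \<Omega>)"
    using bD div_P unfolding bcont_def by (simp cong: image_cong)
  then interpret flux_field \<Omega> P using dom Pc P1 by unfold_locales auto
  have flux: "0 \<le> P z \<bullet> \<nu>" if z: "z \<in> frontier \<Omega>" "outward_unit_normal \<Omega> z \<nu>" for z \<nu>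
  proof -
    define b where "b = (\<Sum>i\<in>UNIV. \<nu> $ i *\<^sub>R G i z)"
    have "G k z = \<nu> $ k *\<^sub>R b" for k
      unfolding b_def by (rule boundary_gradient_normal[OF dom(1,2) u1 uc u(3) G z])
    then have "P z = pohozaev_flux C z (\<lambda>i k. b $ i * \<nu> $ k) 0 0"
      by (simp add: P_def u(3)[OF z(1)] F(2) mult.commute)
    moreover have "0 \<le> z \<bullet> \<nu>" using dom(4) z by (simp add: star_shaped_wrt_origin_def)
    ultimately show ?thesis using pohozaev_flux_boundary[OF C(2), of z \<nu> b] by simp
  qed
  have "(LINT y:\<Omega>|lborel. D y) = (LINT y:\<Omega>|lborel. divergence P y)"
    using dom(1) by (intro set_lebesgue_integral_cong) (auto simp: div_P)
  then have "0 \<le> (LINT y:\<Omega>|lborel. D y)"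
    using integral_divergence_nonneg[OF dim dom(3) flux] by simp
  moreover have "D y \<le> 0" for y
    using F_nonneg[of "u y"] by (simp add: D_def gradient_def)
  ultimately have "D x = 0"
    using bD x by (intro integral_nonpos_imp_zero[OF dom(1) set_integrable_bcont[OF bD dom(1,2)]])
      (auto simp: bcont_def)
  then show ?thesis using F_eq[of "u x"] by (simp add: D_def gradient_def)
qed

lemma elastic_moduli_stress_nonneg:
  assumes "elastic_moduli C"
  shows "0 \<le> (\<Sum>i\<in>UNIV. \<Sum>k\<in>UNIV. stress C a i k * a i k)"
proof -
  have "0 \<le> (\<Sum>i\<in>UNIV. \<Sum>j\<in>UNIV. \<Sum>k\<in>UNIV. \<Sum>l\<in>UNIV.
      C k l i j * (\<chi> i k. a i k) $ i $ k * (\<chi> i k. a i k) $ j $ l)"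
    using assms unfolding elastic_moduli_def by blast
  also have "\<dots> = (\<Sum>i\<in>UNIV. \<Sum>k\<in>UNIV. \<Sum>j\<in>UNIV. \<Sum>l\<in>UNIV. C k l i j * a i k * a j l)"
    by (simp, intro sum.cong refl sum.swap)
  also have "\<dots> = (\<Sum>i\<in>UNIV. \<Sum>k\<in>UNIV. stress C a i k * a i k)"
    by (simp add: stress_def sum_distrib_left mult_ac)
  finally show ?thesis .
qed

text \<open>The moduli for which the divergence of the stress is the Navier operator. With this choice the energy
  is \<open>\<mu>\<close> times the square of the whole gradient plus \<open>\<mu> + lam\<close> times the square of the divergence, so it is nonnegative
  pointwise; twice the strain energy of linear elasticity differs from it by a null Lagrangian only.\<close>

definition isotropic_moduli :: "real \<Rightarrow> real \<Rightarrow> 'n \<Rightarrow> 'n \<Rightarrow> 'n \<Rightarrow> 'n \<Rightarrow> real"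
  where "isotropic_moduli \<mu> lam k l i j =
    \<mu> * (of_bool (i = j) * of_bool (k = l)) + (\<mu> + lam) * (of_bool (i = k) * of_bool (j = l))"

lemma sum_of_bool_eq: "(\<Sum>j\<in>UNIV. of_bool (i = j) * g j) = (g i :: real)" for i :: "'n::finite"
  by (simp add: of_bool_def if_distrib[of "\<lambda>z. z * _"] cong: if_cong)

lemma stress_isotropic:
  "stress (isotropic_moduli \<mu> lam) a i l = \<mu> * a i l + of_bool (i = l) * ((\<mu> + lam) * (\<Sum>j\<in>UNIV. a j j))"
  by (simp add: stress_def isotropic_moduli_def of_bool_def if_distrib[of "\<lambda>z. _ * z"]
      if_distrib[of "\<lambda>z. z * _"] distrib_right sum.distrib sum_distrib_left cong: if_cong)

lemma isotropic_stress_nonneg: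
  assumes "0 \<le> \<mu>" "0 \<le> \<mu> + lam"
  shows "0 \<le> (\<Sum>i\<in>UNIV. \<Sum>k\<in>UNIV. stress (isotropic_moduli \<mu> lam) a i k * a i k)"
proof -
  have "(\<Sum>i\<in>UNIV. \<Sum>k\<in>UNIV. (\<mu> * a i k + of_bool (i = k) * t) * a i k)
      = \<mu> * (\<Sum>i\<in>UNIV. \<Sum>k\<in>UNIV. (a i k)\<^sup>2) + t * (\<Sum>j\<in>UNIV. a j j)" for t
  proof -
    have "(\<mu> * a i k + of_bool (i = k) * t) * a i k = \<mu> * (a i k)\<^sup>2 + of_bool (i = k) * (t * a i k)" for i k
      by (simp add: power2_eq_square algebra_simps)
    then show ?thesis by (simp only: sum.distrib sum_of_bool_eq sum_distrib_left)
  qed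
  then have "(\<Sum>i\<in>UNIV. \<Sum>k\<in>UNIV. stress (isotropic_moduli \<mu> lam) a i k * a i k)
      = \<mu> * (\<Sum>i\<in>UNIV. \<Sum>k\<in>UNIV. (a i k)\<^sup>2) + (\<mu> + lam) * (\<Sum>j\<in>UNIV. a j j)\<^sup>2"
    by (simp only: stress_isotropic power2_eq_square mult.assoc)
  then show ?thesis using assms by (auto intro!: add_nonneg_nonneg mult_nonneg_nonneg sum_nonneg)
qed

lemma navier_imp_anisotropic_system:
  fixes u f :: "real^'n \<Rightarrow> real^'n"
  assumes \<Omega>: "open \<Omega>" and u: "C2_on \<Omega> u" and sys: "navier_system \<mu> lam f \<Omega> u"
  shows "anisotropic_system (isotropic_moduli \<mu> lam) f \<Omega> u"
  unfolding anisotropic_system_def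
proof (intro ballI allI)
  fix x i assume x: "x \<in> \<Omega>"
  let ?h = "\<lambda>j k l. partial_deriv l (partial_deriv k u) x $ j"
  have "((\<lambda>y. \<Sum>j\<in>UNIV. partial_deriv j u y $ j) has_derivative
      (\<lambda>h. \<Sum>j\<in>UNIV. (\<Sum>l\<in>UNIV. h $ l *\<^sub>R partial_deriv l (partial_deriv j u) x) $ j)) (at x)"
    using u by (intro has_derivative_sum bounded_linear.has_derivative[OF bounded_linear_vec_nth]
        C1_on_has_derivative[OF _ x]) (simp add: C2_on_def)
  from partial_deriv_eq[OF this, of i]
  have "gradient (divergence u) x $ i = (\<Sum>j\<in>UNIV. ?h j j i)"
    unfolding gradient_def divergence_def[abs_def]
    by (simp add: axis_def if_distrib[of "\<lambda>z. z *\<^sub>R _"] if_distrib[of "\<lambda>z. z * _"] cong: if_cong)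
  then have grad: "gradient (divergence u) x $ i = (\<Sum>j\<in>UNIV. ?h j i j)"
    by (simp add: partial_deriv_commute[OF \<Omega> x u, of i])
  have "(\<Sum>j\<in>UNIV. \<Sum>k\<in>UNIV. \<Sum>l\<in>UNIV. isotropic_moduli \<mu> lam k l i j * ?h j k l)
      = \<mu> * (\<Sum>k\<in>UNIV. ?h i k k) + (\<mu> + lam) * (\<Sum>j\<in>UNIV. ?h j i j)"
  proof -
    have "isotropic_moduli \<mu> lam k l i j * ?h j k l
        = of_bool (k = l) * (of_bool (i = j) * (\<mu> * ?h j k l))
          + of_bool (j = l) * (of_bool (i = k) * ((\<mu> + lam) * ?h j k l))" for j k l
      by (simp add: isotropic_moduli_def algebra_simps)
    then show ?thesis
      by (simp only: sum.distrib sum_of_bool_eq flip: sum_distrib_left)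
  qed
  also have "\<dots> = (\<mu> *\<^sub>R laplacian u x + (\<mu> + lam) *\<^sub>R gradient (divergence u) x) $ i"
    by (simp add: grad laplacian_def)
  finally show "(\<Sum>j\<in>UNIV. \<Sum>k\<in>UNIV. \<Sum>l\<in>UNIV. isotropic_moduli \<mu> lam k l i j * ?h j k l) + f (u x) $ i = 0"
    using sys x unfolding navier_system_def by (metis vector_add_component zero_index)
qed

theorem theorem2:
  fixes \<Omega> :: "(real^'n) set" and F :: "real^'n \<Rightarrow> real" and f :: "real^'n \<Rightarrow> real^'n"
  assumes dim: "CARD('n) \<ge> 2"
    and domain: "open \<Omega>" "connected \<Omega>" "bounded \<Omega>" "piecewise_smooth_boundary \<Omega>"
    and star: "star_shaped_wrt_origin \<Omega>"
    and F_C1: "C1_on UNIV F"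
    and F_zero: "F 0 = 0"
    and F_nonneg: "\<And>s. (real CARD('n) - 2) / 2 * (\<Sum>k\<in>UNIV. s $ k * partial_deriv k F s)
                         - real CARD('n) * F s \<ge> 0"
    and F_eq: "\<And>s. (real CARD('n) - 2) / 2 * (\<Sum>k\<in>UNIV. s $ k * partial_deriv k F s)
                         - real CARD('n) * F s = 0 \<longleftrightarrow> s = 0"
    and f_def: "\<And>s i. f s $ i = partial_deriv i F s"
  shows "(\<forall>\<mu> lam. \<mu> > 0 \<and> \<mu> + lam > 0 \<longrightarrow>
            \<not> (\<exists>u :: real^'n \<Rightarrow> real^'n.
                 C2_on \<Omega> u \<and> C1_on_closure \<Omega> u \<and> (\<forall>x\<in>frontier \<Omega>. u x = 0) \<and>
                 navier_system \<mu> lam f \<Omega> u \<and> (\<exists>x\<in>\<Omega>. u x \<noteq> 0)))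
       \<and> (\<forall>C. elastic_moduli C \<longrightarrow>
            \<not> (\<exists>u :: real^'n \<Rightarrow> real^'n.
                 C2_on \<Omega> u \<and> C1_on_closure \<Omega> u \<and> (\<forall>x\<in>frontier \<Omega>. u x = 0) \<and>
                 anisotropic_system C f \<Omega> u \<and> (\<exists>x\<in>\<Omega>. u x \<noteq> 0)))"
proof -
  have f: "f = gradient F" by (simp add: fun_eq_iff vec_eq_iff f_def gradient_def)
  have zero: "u x = 0"
    if "\<And>k l i j. C k l i j = C l k j i" "\<And>a. 0 \<le> (\<Sum>i\<in>UNIV. \<Sum>k\<in>UNIV. stress C a i k * a i k)"
      "C2_on \<Omega> u" "C1_on_closure \<Omega> u" "\<forall>x\<in>frontier \<Omega>. u x = 0" "anisotropic_system C f \<Omega> u" "x \<in> \<Omega>"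
    for C :: "'n \<Rightarrow> 'n \<Rightarrow> 'n \<Rightarrow> 'n \<Rightarrow> real" and u :: "real^'n \<Rightarrow> real^'n" and x
  proof (rule pohozaev_nonexistence[OF dim domain(1,3,4) star F_C1 F_zero F_nonneg F_eq[THEN iffD1] that(1-4) _
        that(6)[unfolded f] that(7)])
    fix z assume "z \<in> frontier \<Omega>"
    then show "u z = 0" using that(5) by blast
  qed
  show ?thesis
  proof (intro conjI allI impI notI; elim exE conjE bexE)
    fix \<mu> lam :: real and u x
    assume "0 < \<mu>" "0 < \<mu> + lam" and u: "C2_on \<Omega> u" "C1_on_closure \<Omega> u" "\<forall>x\<in>frontier \<Omega>. u x = 0"
      "navier_system \<mu> lam f \<Omega> u" "x \<in> \<Omega>" "u x \<noteq> 0"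
    have "u x = 0"
    proof (rule zero[OF _ _ u(1-3) navier_imp_anisotropic_system[OF domain(1) u(1,4)] u(5)])
      show "isotropic_moduli \<mu> lam k l i j = isotropic_moduli \<mu> lam l k j i" for k l i j :: 'n
        by (auto simp: isotropic_moduli_def)
      show "0 \<le> (\<Sum>i\<in>UNIV. \<Sum>k\<in>UNIV. stress (isotropic_moduli \<mu> lam) a i k * a i k)" for a :: "'n \<Rightarrow> 'n \<Rightarrow> real"
        using \<open>0 < \<mu>\<close> \<open>0 < \<mu> + lam\<close> by (intro isotropic_stress_nonneg) auto
    qed
    then show False using u(6) by simp
  next
    fix C u x
    assume C: "elastic_moduli C" and u: "C2_on \<Omega> u" "C1_on_closure \<Omega> u" "\<forall>x\<in>frontier \<Omega>. u x = 0"
      "anisotropic_system C f \<Omega> u" "x \<in> \<Omega>" "u x \<noteq> 0"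
    have "C k l i j = C l k j i" for k l i j using C unfolding elastic_moduli_def by blast
    then have "u x = 0" by (rule zero[OF _ elastic_moduli_stress_nonneg[OF C] u(1-5)])
    then show False using u(6) by simp
  qed
qed

end
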